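(* Let $(a_n)_{n\in\mathbb{Z}}$ be real numbers satisfying $0\ne|a_n|\le C r^{|n|}$ for all $n\in\mathbb{Z}$, for some constants $C>0$ and $0<r<1$. Then $\Lambda=\{n+a_n\}_{n\in\mathbb{Z}}$ admits a pair of generators, i.e. there exist $\varphi_1,\varphi_2\in L^1(\mathbb{R})$ such that the linear combinations of the functions $\varphi_1(t-\lambda_1)$ and $\varphi_2(t-\lambda_2)$, $\lambda_1,\lambda_2\in\Lambda$, are dense in $L^1(\mathbb{R})$. *)

theory Defs
  imports "HOL-Analysis.Analysis"
begin

definition translates_dense_L1 :: "real set \<Rightarrow> (real \<Rightarrow> complex) \<Rightarrow> (real \<Rightarrow> complex) \<Rightarrow> bool" where
  "translates_dense_L1 \<Lambda> \<phi>1 \<phi>2 \<longleftrightarrow>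
     (\<forall>f :: real \<Rightarrow> complex. integrable lborel f \<longrightarrow>
       (\<forall>\<epsilon>>0. \<exists>F1 F2 (c1 :: real \<Rightarrow> complex) (c2 :: real \<Rightarrow> complex).
          finite F1 \<and> F1 \<subseteq> \<Lambda> \<and> finite F2 \<and> F2 \<subseteq> \<Lambda> \<and>
          (\<integral>t. norm (f t - ((\<Sum>l\<in>F1. c1 l * \<phi>1 (t - l)) + (\<Sum>l\<in>F2. c2 l * \<phi>2 (t - l))))
             \<partial>lborel) < \<epsilon>))"

definition admits_pair_of_generators :: "real set \<Rightarrow> bool" where
  "admits_pair_of_generators \<Lambda> \<longleftrightarrow>
     (\<exists>\<phi>1 \<phi>2 :: real \<Rightarrow> complex. integrable lborel \<phi>1 \<and> integrable lborel \<phi>2 \<and>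
        translates_dense_L1 \<Lambda> \<phi>1 \<phi>2)"

end

(* The generators are phi_i(t) = sum_m c_i(m) w(t + m), where w is the Gaussian density and the c_i are
   absolutely summable on the integers, c_1 + c_2 = delta, and each Fourier series p_i of c_i vanishes on
   an interval (p_1 is a trapezoid).

   If the translates were not dense, Hahn-Banach would give a nonzero bounded functional L on L^1 killing
   all of them. Expanding w(t - n - s) at s = 0 gives
     exp(s^2/2) L(phi_i(. - n - s)) = sum_k s^k f_k(n),
   where f_k is the convolution of c_i with a bounded sequence h_k. The left side vanishes for s = a_n, so
   once f_0, ..., f_(k-1) are zero, |f_k(n)| <= const |a_n| decays exponentially. The Fourier series of f_k
   is then analytic in a strip, but it vanishes on an interval together with p_i; hence f_k = 0. As
   c_1 + c_2 = delta this yields h_k = 0 for all k, so L kills all polynomials times w, and these are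
   dense in L^1. *)

theory Submission
  imports Defs "HOL-Probability.Probability" "HOL-Complex_Analysis.Complex_Analysis"
begin

section \<open>The Hahn-Banach theorem\<close>

text \<open>The Gaussian serves twice: its translates expand in the shift into a power series that
  converges everywhere, so C may be large, and the coefficients are polynomials times w, whose
  density ends the argument. To isolate f_k(n), the expansion at s = a_n is divided by a_n^k; this
  is where a_n \<noteq> 0 enters. What follows f_k(n) is a_n times a sum bounded uniformly in n, so
  the decay of a_n passes to f_k.

  One generator would not do here. Analyticity kills f_k only if p vanishes on an interval, but then
  f_k = 0 says nothing about the frequencies of h_k in that interval. Two series that vanish on
  disjoint sets and add up to 1 lose no frequency. A trapezoid is flat at 0 and flat at 1, so 1 -
  p_1 vanishes on an interval too, and it is regular enough to have summable coefficients; these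
  make the generators integrable and convolution with bounded sequences meaningful.

  The functional is never represented by a bounded function: dominated convergence is applied to it
  directly. It acts on real functions, and complex approximation is reached through real and
  imaginary parts.\<close>

definition sublinear :: "('a::real_vector \<Rightarrow> real) \<Rightarrow> bool" where
  "sublinear p \<longleftrightarrow> (\<forall>x y. p (x + y) \<le> p x + p y) \<and> (\<forall>c\<ge>0. \<forall>x. p (c *\<^sub>R x) = c * p x)"

lemma sublinear_add: "sublinear p \<Longrightarrow> p (x + y) \<le> p x + p y"
  and sublinear_scale: "sublinear p \<Longrightarrow> c \<ge> 0 \<Longrightarrow> p (c *\<^sub>R x) = c * p x"
  by (auto simp: sublinear_def)

lemma sublinear_0: "sublinear p \<Longrightarrow> p 0 = 0"
  using sublinear_scale[of p 0 0] by simp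

lemma sublinear_ge: "sublinear p \<Longrightarrow> - p (- x) \<le> p x"
  using sublinear_add[of p x "- x"] sublinear_0[of p] by simp

text \<open>The infimum over t of \<open>g x t\<close> pushes q down as far as the direction y
  allows: t = 0 gives \<open>q' x \<le> q x\<close>, and t = 1 at the point \<open>- y\<close> gives
  \<open>- q y\<close>. For a minimal q, which equals its q', the last inequality says that q is
  odd.\<close>

lemma sublinear_reduce:
  assumes q: "sublinear q"
  obtains q' where "sublinear q'" "\<And>x. q' x \<le> q x" "q' (- y) \<le> - q y"
proof -
  define g where "g x t = q (x + t *\<^sub>R y) - t * q y" for x and t :: real
  define q' where "q' x = (INF t\<in>{0..}. g x t)" for x
  have g_ge: "- q (- x) \<le> g x t" if "t \<ge> 0" for x t
  proof -
    have "t * q y = q (- x + (x + t *\<^sub>R y))"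
      using sublinear_scale[OF q that] by simp
    also have "\<dots> \<le> q (- x) + q (x + t *\<^sub>R y)" by (rule sublinear_add[OF q])
    finally show ?thesis by (simp add: g_def)
  qed
  have bdd: "bdd_below (g x ` {0..})" for x
    using g_ge by (intro bdd_belowI2[where m = "- q (- x)"]) auto
  have le: "q' x \<le> g x t" if "t \<ge> 0" for x t
    unfolding q'_def using that by (intro cINF_lower bdd) auto
  have ge: "u \<le> q' x" if "\<And>t. t \<ge> 0 \<Longrightarrow> u \<le> g x t" for u x
    unfolding q'_def using that by (intro cINF_greatest) auto
  have add: "q' (x + z) \<le> q' x + q' z" for x z
  proof -
    have "q' (x + z) - q' z \<le> g x t" if t: "t \<ge> 0" for t
    proof -
      have "q' (x + z) - g x t \<le> g z s" if s: "s \<ge> 0" for s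
      proof -
        have "q' (x + z) \<le> g (x + z) (t + s)" using t s by (intro le) auto
        also have "\<dots> = q ((x + t *\<^sub>R y) + (z + s *\<^sub>R y)) - (t + s) * q y"
          by (simp add: g_def algebra_simps)
        also have "\<dots> \<le> g x t + g z s"
          using sublinear_add[OF q, of "x + t *\<^sub>R y" "z + s *\<^sub>R y"]
          by (simp add: g_def algebra_simps)
        finally show ?thesis by simp
      qed
      then have "q' (x + z) - g x t \<le> q' z" by (rule ge)
      then show ?thesis by simp
    qed
    then have "q' (x + z) - q' z \<le> q' x" by (rule ge)
    then show ?thesis by simp
  qed
  have scale_le: "q' (c *\<^sub>R x) \<le> c * q' x" if c: "c > 0" for c x
  proof -
    have "q' (c *\<^sub>R x) / c \<le> g x t" if t: "t \<ge> 0" for t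
    proof -
      have "q' (c *\<^sub>R x) \<le> g (c *\<^sub>R x) (c * t)" using c t by (intro le) auto
      also have "\<dots> = c * g x t"
        using sublinear_scale[OF q, of c "x + t *\<^sub>R y"] c by (simp add: g_def algebra_simps)
      finally show ?thesis using c by (simp add: field_simps)
    qed
    then have "q' (c *\<^sub>R x) / c \<le> q' x" by (rule ge)
    then show ?thesis using c by (simp add: field_simps)
  qed
  have zero: "q' 0 = 0"
    using le[of 0 0] ge[of 0 0] sublinear_scale[OF q] sublinear_0[OF q]
    by (simp add: g_def)
  have scale: "q' (c *\<^sub>R x) = c * q' x" if "c \<ge> 0" for c x
  proof (cases "c = 0")
    case False
    with that have c: "c > 0" by simp
    have "q' x \<le> inverse c * q' (c *\<^sub>R x)"
      using scale_le[of "inverse c" "c *\<^sub>R x"] c by simp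
    with scale_le[OF c, of x] c show ?thesis by (simp add: field_simps)
  qed (simp add: zero)
  show thesis
  proof
    show "sublinear q'" using add scale by (simp add: sublinear_def)
    show "q' x \<le> q x" for x using le[of 0 x] by (simp add: g_def)
    show "q' (- y) \<le> - q y" using le[of 1 "- y"] sublinear_0[OF q] by (simp add: g_def)
  qed
qed

text \<open>A minimal sublinear functional is linear, so no extension of partial functionals is needed.\<close>

lemma sublinear_minimal:
  assumes p: "sublinear p"
  obtains q where "sublinear q" "\<And>x. q x \<le> p x"
    "\<And>q'. sublinear q' \<Longrightarrow> (\<And>x. q' x \<le> q x) \<Longrightarrow> q' = q"
proof -
  define A where "A = {q. sublinear q \<and> (\<forall>x. q x \<le> p x)}"
  \<comment> \<open>The order is reversed, so that the maximal element from Zorn's lemma is a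
    minimal functional and upper bounds of chains are pointwise infima.\<close>
  define P where "P = (\<lambda>q q' :: 'a \<Rightarrow> real. q' \<le> q)"
  have "\<exists>m\<in>A. \<forall>a\<in>A. P m a \<longrightarrow> a = m"
  proof (rule predicate_Zorn)
    show "partial_order_on A (relation_of P A)"
      by (rule partial_order_on_relation_ofI) (auto simp: P_def)
  next
    fix K assume K: "K \<in> Chains (relation_of P A)"
    then have KA: "K \<subseteq> A" and lin: "\<And>q q'. q \<in> K \<Longrightarrow> q' \<in> K \<Longrightarrow> q \<le> q' \<or> q' \<le> q"
      by (auto simp: Chains_def relation_of_def P_def)
    show "\<exists>u\<in>A. \<forall>a\<in>K. P a u"
    proof (cases "K = {}")
      case True
      then show ?thesis using p by (auto simp: A_def)
    next
      case False
      define u where "u x = (INF q\<in>K. q x)" for x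
      have sub: "sublinear q" "\<And>x. q x \<le> p x" if "q \<in> K" for q
        using that KA by (auto simp: A_def)
      have bdd: "bdd_below ((\<lambda>q. q x) ` K)" for x
      proof (rule bdd_belowI2)
        fix q assume "q \<in> K"
        then show "- p (- x) \<le> q x"
          using sublinear_ge[OF sub(1), of q x] sub(2)[of q "- x"] by linarith
      qed
      have le: "u x \<le> q x" if "q \<in> K" for x q
        unfolding u_def using that by (intro cINF_lower bdd)
      have ge: "v \<le> u x" if "\<And>q. q \<in> K \<Longrightarrow> v \<le> q x" for v x
        unfolding u_def using that False by (intro cINF_greatest) auto
      have add: "u (x + y) \<le> u x + u y" for x y
      proof -
        have "u (x + y) - u y \<le> q x" if q: "q \<in> K" for q
        proof -
          have "u (x + y) - q x \<le> q' y" if q': "q' \<in> K" for q'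
          proof -
            \<comment> \<open>In a chain one of q and q' lies below both, and its subadditivity
              bridges the two different functionals.\<close>
            obtain q'' where "q'' \<in> K" "q'' \<le> q" "q'' \<le> q'"
              using lin[OF q q'] q q' by auto
            then show ?thesis
              using le[of q'' "x + y"] sublinear_add[OF sub(1), of q'' x y]
                le_funD[of q'' q x] le_funD[of q'' q' y] by linarith
          qed
          then have "u (x + y) - q x \<le> u y" by (rule ge)
          then show ?thesis by simp
        qed
        then have "u (x + y) - u y \<le> u x" by (rule ge)
        then show ?thesis by simp
      qed
      have scale: "u (c *\<^sub>R x) = c * u x" if c: "c \<ge> 0" for c x
      proof -
        have "u (c *\<^sub>R x) = (INF q\<in>K. c * q x)"
          unfolding u_def using sublinear_scale[OF sub(1) c] by (intro INF_cong) auto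
        also have "\<dots> = c * u x"
        proof (rule antisym)
          show "(INF q\<in>K. c * q x) \<le> c * u x"
          proof (cases "c = 0")
            case True
            then show ?thesis using False by simp
          next
            case c0: False
            have "bdd_below ((\<lambda>q. c * q x) ` K)"
              using le[of _ x] c by (intro bdd_belowI2[where m = "c * u x"] mult_left_mono) auto
            then have "(INF q\<in>K. c * q x) \<le> c * q x" if "q \<in> K" for q
              using that by (intro cINF_lower)
            then have "(INF q\<in>K. c * q x) / c \<le> u x"
              using c c0 by (intro ge) (simp add: field_simps)
            then show ?thesis using c c0 by (simp add: field_simps)
          qed
          show "c * u x \<le> (INF q\<in>K. c * q x)"
            using False c le by (intro cINF_greatest mult_left_mono) auto
        qed
        finally show ?thesis .
      qed
      have "u x \<le> p x" for x
        using False le sub(2) by (meson ex_in_conv order_trans)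
      with add scale have "u \<in> A" by (simp add: A_def sublinear_def)
      then show ?thesis using le by (auto simp: P_def le_fun_def)
    qed
  qed
  then obtain m where "m \<in> A" "\<And>a. a \<in> A \<Longrightarrow> a \<le> m \<Longrightarrow> a = m" by (auto simp: P_def)
  then show thesis
    by (intro that[of m]) (auto simp: A_def le_fun_def intro: order_trans)
qed

text \<open>Reducing p at x0 before minimising fixes the value there: every L below p' has
  \<open>L (- x0) \<le> - p x0\<close>, and oddness turns this into
  \<open>L x0 \<ge> p x0\<close>.\<close>

theorem Hahn_Banach_sublinear:
  assumes p: "sublinear (p :: 'a::real_vector \<Rightarrow> real)"
  obtains L where "linear L" "\<And>x. L x \<le> p x" "L x0 = p x0"
proof -
  obtain p' where p': "sublinear p'" "\<And>x. p' x \<le> p x" "p' (- x0) \<le> - p x0"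
    using sublinear_reduce[OF p, of x0] by blast
  obtain L where L: "sublinear L" "\<And>x. L x \<le> p' x"
    and min: "\<And>q'. sublinear q' \<Longrightarrow> (\<And>x. q' x \<le> L x) \<Longrightarrow> q' = L"
    using sublinear_minimal[OF p'(1)] by blast
  have odd: "L (- y) = - L y" for y
  proof -
    obtain q' where q': "sublinear q'" "\<And>x. q' x \<le> L x" "q' (- y) \<le> - L y"
      using sublinear_reduce[OF L(1)] by blast
    with min have "q' = L" by blast
    with q'(3) sublinear_ge[OF L(1), of y] show ?thesis by simp
  qed
  have "linear L"
  proof (rule linearI)
    show "L (x + y) = L x + L y" for x y
      using sublinear_add[OF L(1), of x y] sublinear_add[OF L(1), of "- x" "- y"]
        odd[of "x + y"] odd[of x] odd[of y] by simp
    show "L (c *\<^sub>R x) = c *\<^sub>R L x" for c x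
      using sublinear_scale[OF L(1), of c x] sublinear_scale[OF L(1), of "- c" x]
        odd[of "c *\<^sub>R x"] by (cases "c \<ge> 0") auto
  qed
  moreover have "L x0 = p x0"
    using L(2)[of x0] p'(2)[of x0] L(2)[of "- x0"] p'(3) odd[of x0] by linarith
  ultimately show thesis
    using that L(2) p'(2) order_trans by blast
qed

section \<open>Bounded functionals on integrable functions\<close>

text \<open>Functions equal almost everywhere are not identified. A real vector space is all that
  the sublinear Hahn-Banach theorem asks for, and the L^1 seminorm enters only through the sublinear
  functional.\<close>

typedef l1 = "{f :: real \<Rightarrow> real. integrable lborel f}"
  by (rule exI[where x = "\<lambda>_. 0"]) simp

setup_lifting type_definition_l1

instantiation l1 :: real_vector
begin

lift_definition zero_l1 :: l1 is "\<lambda>_. 0" by simp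
lift_definition plus_l1 :: "l1 \<Rightarrow> l1 \<Rightarrow> l1" is "\<lambda>f g x. f x + g x" by simp
lift_definition minus_l1 :: "l1 \<Rightarrow> l1 \<Rightarrow> l1" is "\<lambda>f g x. f x - g x" by simp
lift_definition uminus_l1 :: "l1 \<Rightarrow> l1" is "\<lambda>f x. - f x" by simp
lift_definition scaleR_l1 :: "real \<Rightarrow> l1 \<Rightarrow> l1" is "\<lambda>c f x. c * f x" by simp

instance
  by standard (transfer; simp add: fun_eq_iff algebra_simps)+

end

text \<open>Norm at most one on L^1, formulated for plain functions; nothing is assumed about values
  at functions that are not integrable. The bound makes L respect equality almost
  everywhere.\<close>

locale l1_functional =
  fixes L :: "(real \<Rightarrow> real) \<Rightarrow> real"
  assumes add: "integrable lborel f \<Longrightarrow> integrable lborel g \<Longrightarrow> L (\<lambda>x. f x + g x) = L f + L g"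
    and scale: "integrable lborel f \<Longrightarrow> L (\<lambda>x. c * f x) = c * L f"
    and bound: "integrable lborel f \<Longrightarrow> \<bar>L f\<bar> \<le> (\<integral>x. \<bar>f x\<bar> \<partial>lborel)"

text \<open>The sublinear functional is the L^1 distance to V. It vanishes on V, is at most the L^1
  norm, and takes the same value at g and - g, so a linear functional below it inherits a two-sided
  bound and kills V.\<close>

lemma l1_separation:
  assumes V: "\<And>v. v \<in> V \<Longrightarrow> integrable lborel v" "(\<lambda>_. 0) \<in> V"
    and add: "\<And>u v. u \<in> V \<Longrightarrow> v \<in> V \<Longrightarrow> (\<lambda>x. u x + v x) \<in> V"
    and scale: "\<And>c v. v \<in> V \<Longrightarrow> (\<lambda>x. c * v x) \<in> V"
    and f: "integrable lborel f"
    and dist: "\<And>v. v \<in> V \<Longrightarrow> e \<le> (\<integral>x. \<bar>f x - v x\<bar> \<partial>lborel)"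
  obtains L where "l1_functional L" "\<And>v. v \<in> V \<Longrightarrow> L v = 0" "L f \<ge> e"
proof -
  define d where "d g v = (\<integral>x. \<bar>g x - v x\<bar> \<partial>lborel)" for g v :: "real \<Rightarrow> real"
  define p where "p g = (INF v\<in>V. d (Rep_l1 g) v)" for g
  have int: "integrable lborel (Rep_l1 g)" for g using Rep_l1[of g] by simp
  have bdd: "bdd_below (d g ` V)" for g
    by (rule bdd_belowI2[where m = 0]) (simp add: d_def)
  have le: "p g \<le> d (Rep_l1 g) v" if "v \<in> V" for g v
    unfolding p_def using that by (intro cINF_lower bdd)
  have ge: "u \<le> p g" if "\<And>v. v \<in> V \<Longrightarrow> u \<le> d (Rep_l1 g) v" for u g
    unfolding p_def using that V(2) by (intro cINF_greatest) auto
  have p_add: "p (g + h) \<le> p g + p h" for g h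
  proof -
    have "p (g + h) - p h \<le> d (Rep_l1 g) u" if u: "u \<in> V" for u
    proof -
      have "p (g + h) - d (Rep_l1 g) u \<le> d (Rep_l1 h) v" if v: "v \<in> V" for v
      proof -
        have "p (g + h) \<le> d (Rep_l1 (g + h)) (\<lambda>x. u x + v x)" by (intro le add u v)
        also have "\<dots> \<le> (\<integral>x. \<bar>Rep_l1 g x - u x\<bar> + \<bar>Rep_l1 h x - v x\<bar> \<partial>lborel)"
          unfolding d_def plus_l1.rep_eq using int V(1)[OF u] V(1)[OF v]
          by (intro integral_mono) auto
        also have "\<dots> = d (Rep_l1 g) u + d (Rep_l1 h) v"
          unfolding d_def using int V(1)[OF u] V(1)[OF v] by (intro Bochner_Integration.integral_add) auto
        finally show ?thesis by simp
      qed
      then have "p (g + h) - d (Rep_l1 g) u \<le> p h" by (rule ge)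
      then show ?thesis by simp
    qed
    then have "p (g + h) - p h \<le> p g" by (rule ge)
    then show ?thesis by simp
  qed
  have p_scale_le: "p (c *\<^sub>R g) \<le> \<bar>c\<bar> * p g" if c: "c \<noteq> 0" for c g
  proof -
    have "p (c *\<^sub>R g) / \<bar>c\<bar> \<le> d (Rep_l1 g) v" if v: "v \<in> V" for v
    proof -
      have "p (c *\<^sub>R g) \<le> d (Rep_l1 (c *\<^sub>R g)) (\<lambda>x. c * v x)" by (intro le scale v)
      also have "\<dots> = (\<integral>x. \<bar>c\<bar> * \<bar>Rep_l1 g x - v x\<bar> \<partial>lborel)"
        unfolding d_def scaleR_l1.rep_eq by (simp add: abs_mult flip: right_diff_distrib)
      also have "\<dots> = \<bar>c\<bar> * d (Rep_l1 g) v" by (simp add: d_def)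
      finally show ?thesis using c by (simp add: field_simps)
    qed
    then have "p (c *\<^sub>R g) / \<bar>c\<bar> \<le> p g" by (rule ge)
    then show ?thesis using c by (simp add: field_simps)
  qed
  have p0: "p g = 0" if "Rep_l1 g \<in> V" for g
    using le[OF that, of g] ge[of 0 g] by (simp add: d_def)
  have "sublinear p"
    unfolding sublinear_def
  proof (intro conjI allI impI p_add)
    fix c :: real and g assume c: "c \<ge> 0"
    show "p (c *\<^sub>R g) = c * p g"
    proof (cases "c = 0")
      case True
      then show ?thesis using p0[of 0] V(2) by (simp add: zero_l1.rep_eq)
    next
      case False
      with p_scale_le[of c g] p_scale_le[of "inverse c" "c *\<^sub>R g"] c
      show ?thesis by (simp add: field_simps)
    qed
  qed
  then obtain M where M: "linear M" "\<And>g. M g \<le> p g" "M (Abs_l1 f) = p (Abs_l1 f)"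
    using Hahn_Banach_sublinear by blast
  have Rep: "Rep_l1 (Abs_l1 g) = g" if "integrable lborel g" for g
    using that by (simp add: Abs_l1_inverse)
  have abs_le: "\<bar>M g\<bar> \<le> p g" for g
    using M(2)[of g] M(2)[of "- g"] linear_neg[OF M(1), of g] p_scale_le[of "-1" g] by simp
  have p_le: "p g \<le> (\<integral>x. \<bar>Rep_l1 g x\<bar> \<partial>lborel)" for g
    using le[OF V(2), of g] by (simp add: d_def)
  show thesis
  proof
    show "l1_functional (\<lambda>g. M (Abs_l1 g))"
    proof
      fix g h :: "real \<Rightarrow> real" and c :: real
      assume g: "integrable lborel g"
      show "M (Abs_l1 (\<lambda>x. c * g x)) = c * M (Abs_l1 g)"
        using g linear_scale[OF M(1), of c "Abs_l1 g"]
        by (simp add: scaleR_l1.abs_eq eq_onp_def)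
      show "\<bar>M (Abs_l1 g)\<bar> \<le> (\<integral>x. \<bar>g x\<bar> \<partial>lborel)"
        using order_trans[OF abs_le p_le, of "Abs_l1 g"] Rep[OF g] by simp
      assume h: "integrable lborel h"
      show "M (Abs_l1 (\<lambda>x. g x + h x)) = M (Abs_l1 g) + M (Abs_l1 h)"
        using g h linear_add[OF M(1), of "Abs_l1 g" "Abs_l1 h"]
        by (simp add: plus_l1.abs_eq eq_onp_def)
    qed
    show "M (Abs_l1 v) = 0" if "v \<in> V" for v
      using abs_le[of "Abs_l1 v"] p0[of "Abs_l1 v"] Rep[OF V(1)] that by simp
    show "e \<le> M (Abs_l1 f)"
      unfolding M(3) using dist by (intro ge) (simp add: d_def Rep[OF f])
  qed
qed

context l1_functional
begin

lemma zero: "L (\<lambda>_. 0) = 0"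
  using scale[of "\<lambda>_. 0" 0] by simp

lemma diff: "integrable lborel f \<Longrightarrow> integrable lborel g \<Longrightarrow> L (\<lambda>x. f x - g x) = L f - L g"
  using add[of f "\<lambda>x. - 1 * g x"] scale[of g "- 1"] by simp

lemma sum: "(\<And>i. i \<in> I \<Longrightarrow> integrable lborel (f i)) \<Longrightarrow> L (\<lambda>x. \<Sum>i\<in>I. f i x) = (\<Sum>i\<in>I. L (f i))"
  by (induction I rule: infinite_finite_induct) (simp_all add: zero add)

text \<open>Dominated convergence gives convergence in L^1, where L is continuous. Every later limit
  passes through L in this way.\<close>

lemma tendsto_dominated:
  assumes s: "\<And>i. s i \<in> borel_measurable lborel" and f: "f \<in> borel_measurable lborel"
    and g: "integrable lborel g"
    and lim: "\<And>x. (\<lambda>i. s i x) \<longlonglongrightarrow> f x"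
    and le: "\<And>i x. \<bar>s i x\<bar> \<le> g x"
  shows "(\<lambda>i. L (s i)) \<longlonglongrightarrow> L f"
proof -
  have dom: "\<bar>f x\<bar> \<le> g x" for x
    by (rule LIMSEQ_le_const2[OF tendsto_rabs[OF lim]]) (use le in auto)
  have int_s: "integrable lborel (s i)" for i
    by (rule Bochner_Integration.integrable_bound[OF g s]) (use le in \<open>auto intro!: AE_I2 order_trans[OF le]\<close>)
  have int_f: "integrable lborel f"
    by (rule Bochner_Integration.integrable_bound[OF g f]) (use dom in \<open>auto intro!: AE_I2 order_trans[OF dom]\<close>)
  have "(\<lambda>i. \<integral>x. \<bar>s i x - f x\<bar> \<partial>lborel) \<longlonglongrightarrow> (\<integral>x. 0 \<partial>(lborel :: real measure))"
  proof (rule integral_dominated_convergence[where w = "\<lambda>x. 2 * g x"])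
    show "AE x in lborel. (\<lambda>i. \<bar>s i x - f x\<bar>) \<longlonglongrightarrow> 0"
      using lim by (intro AE_I2 tendsto_rabs_zero) (simp add: LIM_zero_iff)
    have "\<bar>s i x - f x\<bar> \<le> 2 * g x" for i x
      using le[of i x] dom[of x] by linarith
    then show "AE x in lborel. norm \<bar>s i x - f x\<bar> \<le> 2 * g x" for i by simp
  qed (use s f g in auto)
  then have lim0: "(\<lambda>i. \<integral>x. \<bar>s i x - f x\<bar> \<partial>lborel) \<longlonglongrightarrow> 0" by simp
  have "(\<lambda>i. L (s i) - L f) \<longlonglongrightarrow> 0"
  proof (rule Lim_null_comparison[OF always_eventually lim0], rule allI)
    show "norm (L (s i) - L f) \<le> (\<integral>x. \<bar>s i x - f x\<bar> \<partial>lborel)" for i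
      using bound[of "\<lambda>x. s i x - f x"] diff[of "s i" f] int_s[of i] int_f by simp
  qed
  then show ?thesis by (simp add: LIM_zero_iff)
qed

text \<open>The sum of the absolute values is integrable and dominates all partial sums. Absolute
  summability is required at every point, since \<open>tendsto_dominated\<close> works with limits
  at every point.\<close>

lemma sums:
  assumes f: "\<And>i. integrable lborel (f i)"
    and summ: "\<And>x. summable (\<lambda>i. \<bar>f i x\<bar>)"
    and summ_int: "summable (\<lambda>i. \<integral>x. \<bar>f i x\<bar> \<partial>lborel)"
  shows "integrable lborel (\<lambda>x. \<Sum>i. f i x)" and "(\<lambda>i. L (f i)) sums L (\<lambda>x. \<Sum>i. f i x)"
proof -
  have 1: "AE x in lborel. summable (\<lambda>i. norm (f i x))" using summ by simp
  have 2: "summable (\<lambda>i. \<integral>x. norm (f i x) \<partial>lborel)" using summ_int by simp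
  show int: "integrable lborel (\<lambda>x. \<Sum>i. f i x)"
    by (rule integrable_suminf[OF f 1 2])
  have int': "integrable lborel (\<lambda>x. \<Sum>i. \<bar>f i x\<bar>)"
    using f summ summ_int by (intro integrable_suminf) auto
  have "(\<lambda>n. L (\<lambda>x. \<Sum>i<n. f i x)) \<longlonglongrightarrow> L (\<lambda>x. \<Sum>i. f i x)"
  proof (rule tendsto_dominated[OF _ _ int'])
    show "(\<lambda>n. \<Sum>i<n. f i x) \<longlonglongrightarrow> (\<Sum>i. f i x)" for x
      using summ[of x] by (intro summable_LIMSEQ) (rule summable_rabs_cancel)
    fix n x
    have "\<bar>\<Sum>i<n. f i x\<bar> \<le> (\<Sum>i<n. \<bar>f i x\<bar>)" by (rule sum_abs)
    also have "\<dots> \<le> (\<Sum>i. \<bar>f i x\<bar>)" by (intro sum_le_suminf summ) auto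
    finally show "\<bar>\<Sum>i<n. f i x\<bar> \<le> (\<Sum>i. \<bar>f i x\<bar>)" .
  qed (use f int in auto)
  then show "(\<lambda>i. L (f i)) sums L (\<lambda>x. \<Sum>i. f i x)"
    using f by (simp add: sums_def sum)
qed

end

section \<open>Density of polynomials times the Gaussian\<close>

text \<open>The phase b covers sines and keeps the product-to-sum formula inside one shape of term;
  the frequencies are arbitrary reals.\<close>

inductive trig_poly :: "(real \<Rightarrow> real) \<Rightarrow> bool" where
  cos: "trig_poly (\<lambda>y. a * cos (t * y + b))"
| add: "trig_poly f \<Longrightarrow> trig_poly g \<Longrightarrow> trig_poly (\<lambda>y. f y + g y)"

lemma trig_poly_const: "trig_poly (\<lambda>y. c)"
  using trig_poly.cos[of c 0 0] by simp

lemma trig_poly_mult: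
  assumes "trig_poly f" "trig_poly g"
  shows "trig_poly (\<lambda>y. f y * g y)"
  using assms(1)
proof induction
  case (cos a t b)
  from assms(2) show ?case
  proof induction
    case (cos a' t' b')
    have "trig_poly (\<lambda>y. a * a' / 2 * cos ((t - t') * y + (b - b')) + a * a' / 2 * cos ((t + t') * y + (b + b')))"
      by (intro trig_poly.intros)
    also have "(\<lambda>y. a * a' / 2 * cos ((t - t') * y + (b - b')) + a * a' / 2 * cos ((t + t') * y + (b + b'))) =
      (\<lambda>y. a * cos (t * y + b) * (a' * cos (t' * y + b')))"
    proof
      fix y
      have "(t - t') * y + (b - b') = (t * y + b) - (t' * y + b')"
        "(t + t') * y + (b + b') = (t * y + b) + (t' * y + b')" by (simp_all add: algebra_simps)
      then show "a * a' / 2 * cos ((t - t') * y + (b - b')) + a * a' / 2 * cos ((t + t') * y + (b + b')) =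
        a * cos (t * y + b) * (a' * cos (t' * y + b'))"
        by (simp only: cos_add cos_diff) (simp add: algebra_simps)
    qed
    finally show ?case .
  next
    case (add f g)
    then have "trig_poly (\<lambda>y. a * cos (t * y + b) * f y + a * cos (t * y + b) * g y)"
      by (intro trig_poly.add)
    then show ?case by (simp add: distrib_left)
  qed
next
  case (add f f')
  then have "trig_poly (\<lambda>y. f y * g y + f' y * g y)" by (intro trig_poly.add)
  then show ?case by (simp add: distrib_right)
qed

text \<open>Pulls polynomials on the unit circle back to the line. A real-linear map of the plane is
  determined by its values at 1 and at the imaginary unit, and the sine is a cosine with phase - pi
  / 2.\<close>

lemma trig_poly_cis:
  fixes P :: "complex \<Rightarrow> real"
  assumes "real_polynomial_function P"
  shows "trig_poly (\<lambda>y. P (cis (t * y)))"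
  using assms
proof induction
  case (linear P)
  have "P (cis (t * y)) = P 1 * cos (t * y + 0) + P \<i> * cos (t * y + (- pi / 2))" for y
  proof -
    have eq: "cis (t * y) = cos (t * y) *\<^sub>R 1 + sin (t * y) *\<^sub>R \<i>"
      by (simp add: complex_eq_iff)
    show ?thesis
      unfolding eq using linear[THEN bounded_linear.linear]
      by (simp add: linear_add linear_scale cos_diff)
  qed
  then show ?case by (simp only: trig_poly.intros)
qed (auto intro: trig_poly_const trig_poly.add trig_poly_mult)

text \<open>The bound on all of \<^term>\<open>UNIV :: real set\<close> comes from periodicity: the approximation is
  made on the unit circle, wrapping the interval from \<^term>\<open>- N\<close> to \<^term>\<open>N\<close> around it.\<close>

lemma trig_poly_approx:
  assumes cont: "continuous_on UNIV u" and supp: "\<And>y. \<bar>y\<bar> \<ge> R \<Longrightarrow> u y = 0"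
    and B: "\<And>y. \<bar>u y\<bar> \<le> B" and R: "0 < R" "R < N" and e: "0 < e"
  obtains q where "trig_poly q" "\<And>y. \<bar>q y\<bar> \<le> B + e" "\<And>y. \<bar>y\<bar> \<le> N \<Longrightarrow> \<bar>u y - q y\<bar> < e"
proof -
  define v where "v z = u (N / pi * Arg z)" for z
  define c where "c = cos (pi * R / N)"
  have RN: "0 < pi * R / N" "pi * R / N < pi" using R by (auto simp: field_simps)
  \<comment> \<open>\<open>Arg\<close> jumps on the negative real axis, so the circle is split at
    the angles \<plusminus> pi R / N. On the arc around 1 \<open>Arg\<close> is continuous, and on
    the other arc v is zero because u vanishes beyond R.\<close>
  have contArg: "continuous_on (sphere 0 1 \<inter> {z. Re z \<ge> c}) Arg"
  proof (intro continuous_at_imp_continuous_on ballI)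
    fix z assume z: "z \<in> sphere 0 1 \<inter> {z. Re z \<ge> c}"
    have "z \<notin> \<real>\<^sub>\<le>\<^sub>0"
    proof
      assume "z \<in> \<real>\<^sub>\<le>\<^sub>0"
      with z have "Re z = - 1"
        by (auto simp: complex_nonpos_Reals_iff norm_complex_def power2_eq_1_iff)
      moreover have "c > cos pi" unfolding c_def using RN by (intro cos_monotone_0_pi) auto
      ultimately show False using z by simp
    qed
    then show "isCont Arg z" by (rule continuous_at_Arg)
  qed
  have contA: "continuous_on (sphere 0 1 \<inter> {z. Re z \<ge> c}) v"
    unfolding v_def by (intro continuous_on_compose2[OF cont] continuous_on_mult_left contArg) auto
  have vB: "v z = 0" if "norm z = 1" "Re z \<le> c" for z
  proof -
    have "cos \<bar>Arg z\<bar> \<le> cos (pi * R / N)"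
      using that cos_Arg[of z] by (cases "z = 0") (auto simp: c_def abs_if)
    moreover have "\<bar>Arg z\<bar> \<le> pi" using Arg_bounded[of z] by auto
    ultimately have "pi * R / N \<le> \<bar>Arg z\<bar>"
      using RN cos_monotone_0_pi[of "\<bar>Arg z\<bar>" "pi * R / N"] by force
    then have "\<bar>N / pi * Arg z\<bar> \<ge> R"
      using R by (simp add: abs_mult field_simps)
    then show ?thesis unfolding v_def by (rule supp)
  qed
  have contB: "continuous_on (sphere 0 1 \<inter> {z. Re z \<le> c}) v"
    by (rule continuous_on_eq[of _ "\<lambda>_. 0"]) (auto simp: vB)
  have cl: "closed (sphere 0 1 \<inter> {z. Re z \<ge> c})" "closed (sphere 0 1 \<inter> {z. Re z \<le> c})"
    by (auto intro!: closed_Int closed_Collect_le continuous_intros)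
  have un: "(sphere 0 1 \<inter> {z. Re z \<ge> c}) \<union> (sphere 0 1 \<inter> {z. Re z \<le> c}) = sphere 0 1" by auto
  have "continuous_on (sphere 0 1) v"
    using continuous_on_closed_Un[OF cl contA contB] unfolding un .
  then obtain P where P: "real_polynomial_function P" "\<And>z. z \<in> sphere 0 1 \<Longrightarrow> \<bar>v z - P z\<bar> < e"
    using Stone_Weierstrass_real_polynomial_function[OF compact_sphere _ e] by metis
  show thesis
  proof
    show "trig_poly (\<lambda>y. P (cis (pi / N * y)))" by (rule trig_poly_cis[OF P(1)])
    show "\<bar>P (cis (pi / N * y))\<bar> \<le> B + e" for y
      using P(2)[of "cis (pi / N * y)"] B[of "N / pi * Arg (cis (pi / N * y))"]
      by (simp add: v_def)
    show "\<bar>u y - P (cis (pi / N * y))\<bar> < e" if y: "\<bar>y\<bar> \<le> N" for y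
    proof -
      \<comment> \<open>The left end point is exceptional: \<open>cis (- pi)\<close> has argument
        pi, so v takes the value u N there, which agrees with u (- N) as both are 0.\<close>
      have "v (cis (pi / N * y)) = u y"
      proof (cases "y = - N")
        case True
        then have "cis (pi / N * y) = - 1" using R by (simp add: complex_eq_iff)
        then show ?thesis using True supp[of N] supp[of "- N"] R Arg_cis[of pi] by (simp add: v_def)
      next
        case False
        have "- pi < pi / N * y" "pi / N * y \<le> pi"
          using False y R mult_strict_left_mono[of "- N" y pi] mult_left_mono[of y N pi]
          by (auto simp: field_simps abs_le_iff)
        then have "Arg (cis (pi / N * y)) = pi / N * y" by (intro Arg_cis) auto
        then show ?thesis using R by (simp add: v_def)
      qed
      with P(2)[of "cis (pi / N * y)"] show ?thesis by simp
    qed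
  qed
qed

section \<open>Moments of the Gaussian\<close>

lemma integrable_exp_abs_density: "integrable lborel (\<lambda>u. exp (s * \<bar>u\<bar>) * std_normal_density u)"
proof -
  \<comment> \<open>Completing the square: an exponential factor only moves the mean of the Gaussian
    and rescales it.\<close>
  have eq: "exp (t * u) * std_normal_density u = exp (t\<^sup>2 / 2) * normal_density t 1 u" for t u :: real
  proof -
    have "t * u + - u\<^sup>2 / 2 = t\<^sup>2 / 2 + - (u - t)\<^sup>2 / 2"
      by (simp add: power2_eq_square field_simps)
    then have "exp (t * u) * exp (- u\<^sup>2 / 2) = exp (t\<^sup>2 / 2) * exp (- (u - t)\<^sup>2 / 2)"
      by (simp only: flip: exp_add)
    then show ?thesis by (simp add: normal_density_def)
  qed
  have "integrable lborel (\<lambda>u. exp (s * u) * std_normal_density u + exp (- s * u) * std_normal_density u)"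
    unfolding eq by (intro Bochner_Integration.integrable_add integrable_mult_right integrable_normal_density) simp_all
  then show ?thesis
  proof (rule Bochner_Integration.integrable_bound)
    show "AE u in lborel. norm (exp (s * \<bar>u\<bar>) * std_normal_density u) \<le>
      norm (exp (s * u) * std_normal_density u + exp (- s * u) * std_normal_density u)"
    proof (intro AE_I2)
      fix u
      have "exp (s * \<bar>u\<bar>) * std_normal_density u \<le>
        exp (s * u) * std_normal_density u + exp (- s * u) * std_normal_density u"
        by (cases "u \<ge> 0") auto
      then show "norm (exp (s * \<bar>u\<bar>) * std_normal_density u) \<le>
        norm (exp (s * u) * std_normal_density u + exp (- s * u) * std_normal_density u)"
        by (simp add: abs_mult)
    qed
  qed auto
qed

text \<open>The L^1 norm of the k-th coefficient in the expansion of
  \<open>exp (s\<^sup>2 / 2) * std_normal_density (u - s)\<close> in powers of s; it bounds all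
  coefficients obtained through L.\<close>

definition moment :: "nat \<Rightarrow> real" where
  "moment k = (\<integral>u. \<bar>u\<bar> ^ k / fact k * std_normal_density u \<partial>lborel)"

lemma moment_nonneg: "moment k \<ge> 0"
  unfolding moment_def by (intro integral_nonneg_AE AE_I2) auto

lemma integrable_power_density:
  "integrable lborel (\<lambda>u. (u - j) ^ k * std_normal_density (u - j))"
  "integrable lborel (\<lambda>u. \<bar>u - j\<bar> ^ k * std_normal_density (u - j))"
  using lborel_integrable_real_affine[OF integrable_std_normal_moment[of k], of 1 "- j"]
    lborel_integrable_real_affine[OF integrable_std_normal_moment_abs[of k], of 1 "- j"]
  by (simp_all add: mult.commute)

lemma integral_power_density:
  "(\<integral>u. \<bar>u - j\<bar> ^ k / fact k * std_normal_density (u - j) \<partial>lborel) = moment k"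
  unfolding moment_def
  using lborel_integral_real_affine[of 1 "\<lambda>u. \<bar>u\<bar> ^ k / fact k * std_normal_density u" "- j"] by simp

text \<open>The partial sums are integrals of partial sums of \<open>exp (s * \<bar>u\<bar>)\<close>
  against the density. The radius of convergence is infinite, which later permits s = C for any
  C.\<close>

lemma summable_moment:
  assumes s: "s \<ge> 0"
  shows "summable (\<lambda>k. s ^ k * moment k)"
proof (rule summableI_nonneg_bounded)
  show "0 \<le> s ^ k * moment k" for k using s moment_nonneg by simp
  fix n
  have int: "integrable lborel (\<lambda>u. \<bar>u\<bar> ^ k / fact k * std_normal_density u)" for k
    using integrable_divide[OF integrable_power_density(2)[of 0 k], of "fact k"] by simp
  have "(\<Sum>k<n. s ^ k * moment k) = (\<integral>u. (\<Sum>k<n. s ^ k * (\<bar>u\<bar> ^ k / fact k * std_normal_density u)) \<partial>lborel)"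
    unfolding moment_def
    by (subst Bochner_Integration.integral_sum) (auto intro!: integrable_mult_right int simp del: times_divide_eq_left)
  also have "\<dots> \<le> (\<integral>u. exp (s * \<bar>u\<bar>) * std_normal_density u \<partial>lborel)"
  proof (intro integral_mono integrable_exp_abs_density)
    show "integrable lborel (\<lambda>u. \<Sum>k<n. s ^ k * (\<bar>u\<bar> ^ k / fact k * std_normal_density u))"
      by (intro Bochner_Integration.integrable_sum integrable_mult_right int)
    fix u :: real
    have "(\<Sum>k<n. s ^ k * (\<bar>u\<bar> ^ k / fact k * std_normal_density u)) =
      (\<Sum>k<n. inverse (fact k) * (s * \<bar>u\<bar>) ^ k) * std_normal_density u"
      by (simp add: sum_distrib_left power_mult_distrib divide_inverse mult_ac)
    also have "\<dots> \<le> exp (s * \<bar>u\<bar>) * std_normal_density u"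
    proof (intro mult_right_mono)
      have "(\<lambda>k. inverse (fact k) * (s * \<bar>u\<bar>) ^ k) sums exp (s * \<bar>u\<bar>)"
        using exp_converges[of "s * \<bar>u\<bar>"] by (simp add: scaleR_conv_of_real)
      then show "(\<Sum>k<n. inverse (fact k) * (s * \<bar>u\<bar>) ^ k) \<le> exp (s * \<bar>u\<bar>)"
        using s sum_le_suminf[of "\<lambda>k. inverse (fact k) * (s * \<bar>u\<bar>) ^ k" "{..<n}"] by (simp add: sums_iff)
    qed auto
    finally show "(\<Sum>k<n. s ^ k * (\<bar>u\<bar> ^ k / fact k * std_normal_density u)) \<le>
      exp (s * \<bar>u\<bar>) * std_normal_density u" .
  qed
  finally show "(\<Sum>k<n. s ^ k * moment k) \<le> (\<integral>u. exp (s * \<bar>u\<bar>) * std_normal_density u \<partial>lborel)" .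
qed

section \<open>Functionals that annihilate all moments of the Gaussian\<close>

context l1_functional
begin

text \<open>The bound \<open>1 / fact k\<close> is shared by the coefficients of exp, cos and sin.
  One termwise evaluation of L thus serves both the trigonometric polynomials and the Taylor
  expansion of Gaussian translates.\<close>

lemma power_series_density:
  assumes b: "\<And>k. \<bar>b k\<bar> \<le> 1 / fact k"
  shows "(\<lambda>k. b k * t ^ k * L (\<lambda>y. (y - j) ^ k * std_normal_density (y - j))) sums
    L (\<lambda>y. (\<Sum>k. b k * (t * (y - j)) ^ k) * std_normal_density (y - j))"
proof -
  define f where "f k y = b k * t ^ k * ((y - j) ^ k * std_normal_density (y - j))" for k y
  have f_int: "integrable lborel (f k)" for k
    unfolding f_def by (intro integrable_mult_right integrable_power_density)
  have f_le: "\<bar>f k y\<bar> \<le> \<bar>t\<bar> ^ k * (\<bar>y - j\<bar> ^ k / fact k * std_normal_density (y - j))" for k y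
    using mult_right_mono[OF b, of "\<bar>t\<bar> ^ k * \<bar>y - j\<bar> ^ k * std_normal_density (y - j)" k]
    by (simp add: f_def abs_mult power_abs mult_ac)
  have summ_b: "summable (\<lambda>k. \<bar>b k * x ^ k\<bar>)" for x
  proof (rule summable_comparison_test')
    show "summable (\<lambda>k. inverse (fact k) * \<bar>x\<bar> ^ k)" by (rule summable_exp)
    show "norm \<bar>b k * x ^ k\<bar> \<le> inverse (fact k) * \<bar>x\<bar> ^ k" for k
      using mult_right_mono[OF b, of "\<bar>x\<bar> ^ k" k] by (simp add: abs_mult power_abs field_simps)
  qed
  have summ: "summable (\<lambda>k. \<bar>f k y\<bar>)" for y
    using summable_mult2[OF summ_b[of "t * (y - j)"], of "std_normal_density (y - j)"]
    by (simp add: f_def abs_mult power_mult_distrib mult_ac)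
  have summ_int: "summable (\<lambda>k. \<integral>y. \<bar>f k y\<bar> \<partial>lborel)"
  proof (rule summable_comparison_test')
    show "summable (\<lambda>k. \<bar>t\<bar> ^ k * moment k)" by (rule summable_moment) simp
    fix k
    have "(\<integral>y. \<bar>f k y\<bar> \<partial>lborel) \<le> (\<integral>y. \<bar>t\<bar> ^ k * (\<bar>y - j\<bar> ^ k / fact k * std_normal_density (y - j)) \<partial>lborel)"
      using f_int integrable_divide[OF integrable_power_density(2)[of j k], of "fact k"]
      by (intro integral_mono f_le integrable_mult_right) auto
    also have "\<dots> = \<bar>t\<bar> ^ k * moment k"
      unfolding integral_power_density[of j k, symmetric] by (rule integral_mult_right_zero)
    finally show "norm (\<integral>y. \<bar>f k y\<bar> \<partial>lborel) \<le> \<bar>t\<bar> ^ k * moment k" by simp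
  qed
  have "(\<Sum>k. f k y) = (\<Sum>k. b k * (t * (y - j)) ^ k) * std_normal_density (y - j)" for y
    using suminf_mult2[OF summable_rabs_cancel[OF summ_b[of "t * (y - j)"]], of "std_normal_density (y - j)"]
    by (simp add: f_def power_mult_distrib mult_ac)
  moreover have "L (f k) = b k * t ^ k * L (\<lambda>y. (y - j) ^ k * std_normal_density (y - j))" for k
    unfolding f_def by (intro scale integrable_power_density)
  ultimately show ?thesis using sums(2)[OF f_int summ summ_int] by simp
qed

text \<open>Against the Gaussian, cos and sin are power series that L evaluates term by term, and
  each term is a multiple of a vanishing moment.\<close>

lemma trig_poly_eq_0:
  assumes mom: "\<And>k. L (\<lambda>y. y ^ k * std_normal_density y) = 0" and q: "trig_poly q"
  shows "integrable lborel (\<lambda>y. q y * std_normal_density y)" "L (\<lambda>y. q y * std_normal_density y) = 0"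
  using q
proof induction
  case (cos a t b)
  have b1: "\<bar>cos_coeff k\<bar> \<le> 1 / fact k" "\<bar>sin_coeff k\<bar> \<le> 1 / fact k" for k
    by (auto simp: cos_coeff_def sin_coeff_def abs_mult power_abs)
  have cos0: "L (\<lambda>y. cos (t * y) * std_normal_density y) = 0"
    using power_series_density[OF b1(1), of t 0] mom cos_converges[of "t * _"]
    by (simp add: sums_iff)
  have sin0: "L (\<lambda>y. sin (t * y) * std_normal_density y) = 0"
    using power_series_density[OF b1(2), of t 0] mom sin_converges[of "t * _"]
    by (simp add: sums_iff)
  have int: "integrable lborel (\<lambda>y. cos (t * y) * std_normal_density y)"
    "integrable lborel (\<lambda>y. sin (t * y) * std_normal_density y)"
    by (rule Bochner_Integration.integrable_bound[OF integrable_normal_density[where \<mu> = 0 and \<sigma> = 1]];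
        auto intro!: AE_I2 simp: abs_mult intro!: mult_left_le_one_le abs_cos_le_one abs_sin_le_one)+
  have eq: "(\<lambda>y. a * cos (t * y + b) * std_normal_density y) =
    (\<lambda>y. a * cos b * (cos (t * y) * std_normal_density y) - a * sin b * (sin (t * y) * std_normal_density y))"
    by (auto simp: cos_add algebra_simps)
  { case 1 show ?case unfolding eq by (intro Bochner_Integration.integrable_diff integrable_mult_right int) }
  { case 2 show ?case unfolding eq
      by (subst diff) (auto intro!: integrable_mult_right int simp: scale[OF int(1)] scale[OF int(2)] cos0 sin0) }
next
  case (add f g)
  { case 1 show ?case using add by (auto simp: distrib_right) }
  { case 2 show ?case using l1_functional.add[OF l1_functional_axioms add.IH(1,3)] add.IH(2,4)
      by (auto simp: distrib_right) }
qed

text \<open>The density is continuous and positive, so u divided by it is still continuous with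
  compact support, and this quotient is what gets approximated by trigonometric polynomials.\<close>

lemma compact_support_eq_0:
  assumes mom: "\<And>k. L (\<lambda>y. y ^ k * std_normal_density y) = 0"
    and cont: "continuous_on UNIV u" and supp: "\<And>y. \<bar>y\<bar> \<ge> R \<Longrightarrow> u y = 0"
  shows "L u = 0"
proof -
  define R' where "R' = max R 1"
  define v where "v y = u y / std_normal_density y" for y
  have pos: "std_normal_density y > 0" for y by (rule normal_density_pos) simp
  have contv: "continuous_on UNIV v"
    unfolding v_def std_normal_density_def
    by (intro continuous_intros cont) (auto simp: real_sqrt_eq_zero_cancel_iff)
  have suppv: "v y = 0" if "\<bar>y\<bar> \<ge> R'" for y using that supp by (simp add: v_def R'_def)
  have "compact (v ` {-R'..R'})"
    by (intro compact_continuous_image continuous_on_subset[OF contv]) auto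
  then obtain B where B: "\<And>y. y \<in> {-R'..R'} \<Longrightarrow> \<bar>v y\<bar> \<le> B" "B > 0"
    using compact_imp_bounded[of "v ` {-R'..R'}"] by (fastforce simp: bounded_pos)
  have Bv: "\<bar>v y\<bar> \<le> B" for y
    using B suppv[of y] by (cases "y \<in> {-R'..R'}") (auto simp: abs_le_iff)
  \<comment> \<open>The period grows with n while the error shrinks, so the approximants converge at
    every point. Their bound holds on the whole line and makes
    \<open>(B + 1) * std_normal_density y\<close> a dominating function.\<close>
  have "\<exists>q. trig_poly q \<and> (\<forall>y. \<bar>q y\<bar> \<le> B + 1 / (real n + 1)) \<and>
      (\<forall>y. \<bar>y\<bar> \<le> R' + real n + 1 \<longrightarrow> \<bar>v y - q y\<bar> < 1 / (real n + 1))" for n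
  proof (rule trig_poly_approx[where u = v and R = R' and B = B and N = "R' + real n + 1" and e = "1 / (real n + 1)",
        OF contv suppv Bv])
    show "0 < R'" "R' < R' + real n + 1" "0 < 1 / (real n + 1)" by (auto simp: R'_def)
    fix q assume "trig_poly q" "\<And>y. \<bar>q y\<bar> \<le> B + 1 / (real n + 1)"
      "\<And>y. \<bar>y\<bar> \<le> R' + real n + 1 \<Longrightarrow> \<bar>v y - q y\<bar> < 1 / (real n + 1)"
    then show ?thesis by blast
  qed
  then obtain q where q: "\<And>n. trig_poly (q n)" "\<And>n y. \<bar>q n y\<bar> \<le> B + 1 / (real n + 1)"
    "\<And>n y. \<bar>y\<bar> \<le> R' + real n + 1 \<Longrightarrow> \<bar>v y - q n y\<bar> < 1 / (real n + 1)"
    by metis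
  have "(\<lambda>n. L (\<lambda>y. q n y * std_normal_density y)) \<longlonglongrightarrow> L (\<lambda>y. v y * std_normal_density y)"
  proof (rule tendsto_dominated)
    show "integrable lborel (\<lambda>y. (B + 1) * std_normal_density y)" by simp
    show "(\<lambda>y. q n y * std_normal_density y) \<in> borel_measurable lborel" for n
      using trig_poly_eq_0(1)[OF mom q(1)] by (rule borel_measurable_integrable)
    show "(\<lambda>y. v y * std_normal_density y) \<in> borel_measurable lborel"
      using borel_measurable_continuous_onI[OF contv] by simp
    show "\<bar>q n y * std_normal_density y\<bar> \<le> (B + 1) * std_normal_density y" for n y
    proof -
      have "\<bar>q n y\<bar> \<le> B + 1" using q(2)[of n y] by (rule order_trans) (simp add: field_simps)
      then show ?thesis by (simp add: abs_mult mult_right_mono)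
    qed
    show "(\<lambda>n. q n y * std_normal_density y) \<longlonglongrightarrow> v y * std_normal_density y" for y
    proof (intro tendsto_mult tendsto_const)
      have "(\<lambda>n. q n y - v y) \<longlonglongrightarrow> 0"
      proof (rule Lim_null_comparison)
        show "(\<lambda>n. 1 / (real n + 1)) \<longlonglongrightarrow> 0"
          using LIMSEQ_inverse_real_of_nat by (simp add: inverse_eq_divide add.commute)
        show "\<forall>\<^sub>F n in sequentially. norm (q n y - v y) \<le> 1 / (real n + 1)"
          using eventually_ge_at_top[of "nat \<lceil>\<bar>y\<bar>\<rceil>"]
        proof eventually_elim
          case (elim n)
          then have "\<bar>y\<bar> \<le> real n" by linarith
          then have "\<bar>y\<bar> \<le> R' + real n + 1" by (simp add: R'_def)
          from q(3)[OF this] show ?case by (simp add: abs_minus_commute)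
        qed
      qed
      then show "(\<lambda>n. q n y) \<longlonglongrightarrow> v y" by (simp add: LIM_zero_iff)
    qed
  qed
  then have "(\<lambda>n. 0 :: real) \<longlonglongrightarrow> L (\<lambda>y. v y * std_normal_density y)"
    by (simp add: trig_poly_eq_0(2)[OF mom q(1)])
  then have "L (\<lambda>y. v y * std_normal_density y) = 0" by (simp add: LIMSEQ_const_iff)
  then show ?thesis using pos[THEN less_imp_neq] by (simp add: v_def)
qed

lemma interval_eq_0:
  assumes mom: "\<And>k. L (\<lambda>y. y ^ k * std_normal_density y) = 0"
  shows "L (indicator {a..b}) = 0"
proof (cases "a \<le> b")
  case False
  then have "indicator {a..b} = (\<lambda>_. 0 :: real)" by (auto simp: indicator_def)
  then show ?thesis using zero by simp
next
  case True
  \<comment> \<open>A continuous tent over the interval: the inner maximum is the distance from y to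
    [a, b], and n is the slope of the flanks.\<close>
  define u where "u n y = max 0 (1 - real n * max 0 (max (a - y) (y - b)))" for n :: nat and y
  have u0: "u n y = 0" if "n \<ge> 1" "y \<le> a - 1 \<or> y \<ge> b + 1" for n y
  proof -
    have "1 * 1 \<le> real n * max 0 (max (a - y) (y - b))"
      using that by (intro mult_mono) auto
    then show ?thesis by (simp add: u_def)
  qed
  have cont: "continuous_on UNIV (u n)" for n
    unfolding u_def by (intro continuous_intros)
  \<comment> \<open>The index starts at 1: \<open>u 0\<close> is constantly 1, whereas all later
    ones are supported in [a - 1, b + 1].\<close>
  have "(\<lambda>n. L (u (Suc n))) \<longlonglongrightarrow> L (indicator {a..b})"
  proof (rule tendsto_dominated)
    show "integrable lborel (indicator {a - 1..b + 1} :: real \<Rightarrow> real)"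
      by (intro integrable_real_indicator emeasure_bounded_finite) auto
    show "u (Suc n) \<in> borel_measurable lborel" for n
      using borel_measurable_continuous_onI[OF cont] by simp
    show "\<bar>u (Suc n) y\<bar> \<le> indicator {a - 1..b + 1} y" for n y
      using u0[of "Suc n" y] by (auto simp: indicator_def) (auto simp: u_def)
    show "(\<lambda>n. u (Suc n) y) \<longlonglongrightarrow> indicator {a..b} y" for y
    proof (cases "y \<in> {a..b}")
      case True
      then show ?thesis by (simp add: u_def)
    next
      case False
      define d where "d = max 0 (max (a - y) (y - b))"
      have "d > 0" using False by (auto simp: d_def)
      have "\<forall>\<^sub>F n in sequentially. 1 / d \<le> real (Suc n)"
        using eventually_ge_at_top[of "nat \<lceil>1 / d\<rceil>"] by (rule eventually_mono) linarith
      then have "\<forall>\<^sub>F n in sequentially. u (Suc n) y = 0"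
        by (rule eventually_mono) (use \<open>d > 0\<close> in \<open>simp add: u_def field_simps flip: d_def\<close>)
      then show ?thesis using False by (simp add: tendsto_eventually)
    qed
  qed auto
  moreover have "L (u (Suc n)) = 0" for n
    by (rule compact_support_eq_0[OF mom cont, of "\<bar>a\<bar> + \<bar>b\<bar> + 1"]) (auto intro!: u0)
  ultimately show ?thesis by (simp add: LIMSEQ_const_iff)
qed

text \<open>Half-lines are an intersection-stable generator of the Borel sets. Cutting down to a
  bounded window keeps every indicator integrable, so complements and disjoint unions can be passed
  through L.\<close>

lemma bounded_borel_eq_0:
  assumes mom: "\<And>k. L (\<lambda>y. y ^ k * std_normal_density y) = 0"
    and A: "A \<in> sets borel"
  shows "L (indicator (A \<inter> {- n..n})) = 0"
proof -
  have eq: "sets borel = sigma_sets UNIV (range (\<lambda>a. {..a :: real}))"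
    unfolding borel_eq_atMost by (rule sets_measure_of) simp
  have "Int_stable (range (\<lambda>a. {..a :: real}))"
    by (auto simp: Int_stable_def)
  moreover have "range (\<lambda>a. {..a :: real}) \<subseteq> Pow UNIV" by simp
  moreover have "A \<in> sigma_sets UNIV (range (\<lambda>a. {..a :: real}))" using A by (simp only: eq)
  ultimately show ?thesis
  proof (induction rule: sigma_sets_induct_disjoint)
    case (basic A)
    then obtain a where "A = {..a}" by auto
    then have "A \<inter> {- n..n} = {- n..min a n}" by auto
    then show ?case using interval_eq_0[OF mom] by simp
  next
    case empty
    have "indicator ({} \<inter> {- n..n}) = (\<lambda>_. 0 :: real)" by (auto simp: indicator_def)
    then show ?case using zero by simp
  next
    case (compl A)
    then have A: "A \<in> sets borel" by (simp only: eq)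
    have "L (indicator ((UNIV - A) \<inter> {- n..n})) = L (\<lambda>x. indicator {- n..n} x - indicator (A \<inter> {- n..n}) x)"
      by (intro arg_cong[of _ _ L]) (auto simp: indicator_def)
    also have "\<dots> = L (indicator {- n..n}) - L (indicator (A \<inter> {- n..n}))"
      using A by (intro diff) (auto intro!: integrable_real_indicator emeasure_bounded_finite)
    finally show ?case using compl interval_eq_0[OF mom] by simp
  next
    case (union A)
    then have A: "A i \<in> sets borel" for i by (simp only: eq) auto
    have "(\<lambda>k. L (\<lambda>x. \<Sum>i<k. indicator (A i \<inter> {- n..n}) x)) \<longlonglongrightarrow> L (indicator (\<Union> (range A) \<inter> {- n..n}))"
    proof (rule tendsto_dominated)
      have dis: "disjoint_family (\<lambda>i. A i \<inter> {- n..n})"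
        using union(1) by (auto simp: disjoint_family_on_def)
      have sum_eq: "(\<Sum>i<k. indicator (A i \<inter> {- n..n}) x) = (indicator (\<Union>i<k. A i \<inter> {- n..n}) x :: real)" for k x
        using disjoint_family_on_mono[OF _ dis, of "{..<k}"]
        by (intro indicator_UN_disjoint[symmetric]) auto
      show "integrable lborel (indicator {- n..n} :: real \<Rightarrow> real)"
        by (intro integrable_real_indicator emeasure_bounded_finite) auto
      show "\<bar>\<Sum>i<k. indicator (A i \<inter> {- n..n}) x\<bar> \<le> (indicator {- n..n} x :: real)" for k x
        by (subst sum_eq) (auto simp: indicator_def)
      show "(\<lambda>k. \<Sum>i<k. indicator (A i \<inter> {- n..n}) x :: real) \<longlonglongrightarrow> indicator (\<Union> (range A) \<inter> {- n..n}) x" for x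
      proof -
        have "(\<lambda>k. indicator (\<Union>i<k. A i \<inter> {- n..n}) x :: real) \<longlonglongrightarrow> indicator (\<Union>i. A i \<inter> {- n..n}) x"
          by (rule LIMSEQ_indicator_UN)
        then show ?thesis by (simp add: sum_eq)
      qed
    qed (use A in \<open>auto intro!: borel_measurable_indicator sets.Int sets.countable_UN\<close>)
    moreover have "L (\<lambda>x. \<Sum>i<k. indicator (A i \<inter> {- n..n}) x) = 0" for k
      using A union(3) by (subst sum) (auto intro!: integrable_real_indicator emeasure_bounded_finite)
    ultimately show ?case by (simp add: LIMSEQ_const_iff)
  qed
qed

text \<open>The dual form of the density of polynomials times the Gaussian in L^1. Sets of finite
  measure are exhausted by bounded windows, and the rest is the standard induction over integrable
  functions.\<close>

theorem eq_0_if_moments_eq_0: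
  assumes mom: "\<And>k. L (\<lambda>y. y ^ k * std_normal_density y) = 0"
    and f: "integrable lborel f"
  shows "L f = 0"
  using f
proof induction
  case (base A c)
  have "(\<lambda>n. L (indicator (A \<inter> {- real n..real n}))) \<longlonglongrightarrow> L (indicator A)"
  proof (rule tendsto_dominated)
    show "integrable lborel (indicator A :: real \<Rightarrow> real)"
      using base by (intro integrable_real_indicator) auto
    show "(\<lambda>n. indicator (A \<inter> {- real n..real n}) x :: real) \<longlonglongrightarrow> indicator A x" for x
    proof (rule tendsto_eventually)
      show "\<forall>\<^sub>F n in sequentially. indicator (A \<inter> {- real n..real n}) x = (indicator A x :: real)"
        using eventually_ge_at_top[of "nat \<lceil>\<bar>x\<bar>\<rceil>"]
      proof eventually_elim
        case (elim n)
        then have "\<bar>x\<bar> \<le> real n" by linarith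
        then show ?case by (auto simp: indicator_def)
      qed
    qed
  qed (use base in \<open>auto simp: indicator_def\<close>)
  then have "L (indicator A) = 0"
    using bounded_borel_eq_0[OF mom] base by (simp add: LIMSEQ_const_iff)
  then show ?case
    using scale[of "indicator A" c] base by (simp add: mult.commute)
next
  case (add f g)
  then show ?case using l1_functional.add[OF l1_functional_axioms] by simp
next
  case (lim f s)
  have "(\<lambda>i. L (s i)) \<longlonglongrightarrow> L f"
    using lim by (intro tendsto_dominated[where g = "\<lambda>x. 2 * \<bar>f x\<bar>"]) auto
  then show ?case using lim by (simp add: LIMSEQ_const_iff)
qed

end

section \<open>Convolution and Fourier series on the integers\<close>

definition conv :: "(int \<Rightarrow> complex) \<Rightarrow> (int \<Rightarrow> complex) \<Rightarrow> int \<Rightarrow> complex" where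
  "conv c h n = (\<Sum>\<^sub>\<infinity>m. c m * h (n - m))"

text \<open>The minus sign makes the characters \<open>cis (n * x)\<close> eigenvectors of
  convolution with c, with eigenvalue \<open>fourier c x\<close>.\<close>

definition fourier :: "(int \<Rightarrow> complex) \<Rightarrow> real \<Rightarrow> complex" where
  "fourier c x = (\<Sum>\<^sub>\<infinity>m. c m * cis (- (of_int m * x)))"

lemma summable_on_mult_bounded:
  fixes c h :: "'a \<Rightarrow> complex"
  assumes c: "c summable_on UNIV" and h: "\<And>m. norm (h m) \<le> B"
  shows "(\<lambda>m. c m * h m) summable_on UNIV"
proof -
  have "(\<lambda>m. norm (c m) * B) summable_on UNIV"
    using c by (intro summable_on_cmult_left) (simp add: summable_on_iff_abs_summable_on_complex)
  then have "(\<lambda>m. norm (c m * h m)) summable_on UNIV"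
    by (rule Infinite_Sum.abs_summable_on_comparison_test') (auto simp: norm_mult intro!: mult_left_mono h)
  then show ?thesis by (simp add: summable_on_iff_abs_summable_on_complex)
qed

text \<open>Joint summability, after the substitution of j for the sum of both indices, is what the
  exchange of sums in the associativity of \<open>conv\<close> requires; with h = 1 it also gives
  summability of a convolution.\<close>

lemma summable_on_conv_product:
  fixes c d h :: "int \<Rightarrow> complex"
  assumes c: "c summable_on UNIV" and d: "d summable_on UNIV" and h: "\<And>m. norm (h m) \<le> B"
  shows "(\<lambda>(m, j). d m * c (j - m) * h j) summable_on UNIV \<times> UNIV"
proof -
  have c': "(\<lambda>m. norm (c m)) summable_on UNIV" and d': "(\<lambda>m. norm (d m)) summable_on UNIV"
    using c d by (simp_all flip: summable_on_iff_abs_summable_on_complex)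
  have "(\<lambda>(m, j). norm (d m) * (norm (c (j - m)) * B)) summable_on UNIV \<times> UNIV"
  proof (rule summable_on_SigmaI)
    show "((\<lambda>j. case (m, j) of (m, j) \<Rightarrow> norm (d m) * (norm (c (j - m)) * B)) has_sum
      norm (d m) * ((\<Sum>\<^sub>\<infinity>k. norm (c k)) * B)) UNIV" for m
    proof -
      have "((\<lambda>j. norm (c (j - m))) has_sum (\<Sum>\<^sub>\<infinity>k. norm (c k))) UNIV \<longleftrightarrow>
        ((\<lambda>k. norm (c k)) has_sum (\<Sum>\<^sub>\<infinity>k. norm (c k))) UNIV"
        by (rule has_sum_reindex_bij_witness[where i = "\<lambda>k. k + m" and j = "\<lambda>j. j - m"]) auto
      then have "((\<lambda>j. norm (c (j - m))) has_sum (\<Sum>\<^sub>\<infinity>k. norm (c k))) UNIV"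
        using c' by simp
      then show ?thesis by (auto intro!: has_sum_cmult_right has_sum_cmult_left)
    qed
    show "(\<lambda>m. norm (d m) * ((\<Sum>\<^sub>\<infinity>k. norm (c k)) * B)) summable_on UNIV"
      by (intro summable_on_cmult_left d')
    show "0 \<le> (case (m, j) of (m, j) \<Rightarrow> norm (d m) * (norm (c (j - m)) * B))" for m j
      using order_trans[OF norm_ge_zero h] by auto
  qed
  then have "(\<lambda>p. norm (case p of (m, j) \<Rightarrow> d m * c (j - m) * h j)) summable_on UNIV \<times> UNIV"
    by (rule Infinite_Sum.abs_summable_on_comparison_test')
       (auto simp: norm_mult mult.assoc intro!: mult_left_mono h)
  then show ?thesis by (simp add: summable_on_iff_abs_summable_on_complex)
qed

lemma summable_on_conv:
  assumes c: "c summable_on UNIV" and d: "d summable_on UNIV"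
  shows "conv d c summable_on UNIV"
proof -
  have "(\<lambda>(m, j). d m * c (j - m)) summable_on UNIV \<times> UNIV"
    using summable_on_conv_product[OF c d, of "\<lambda>_. 1" 1] by simp
  then have "(\<lambda>(j, m). d m * c (j - m)) summable_on UNIV \<times> UNIV"
    by (subst (asm) summable_on_swap) simp
  then have "(\<lambda>j. \<Sum>\<^sub>\<infinity>m. d m * c (j - m)) summable_on UNIV"
    by (rule summable_on_Sigma_banach)
  then show ?thesis by (simp add: conv_def[abs_def])
qed

lemma conv_conv:
  assumes c: "c summable_on UNIV" and d: "d summable_on UNIV" and h: "\<And>m. norm (h m) \<le> B"
  shows "conv d (conv c h) n = conv (conv d c) h n"
proof -
  have "conv d (conv c h) n = (\<Sum>\<^sub>\<infinity>m. \<Sum>\<^sub>\<infinity>j. d m * c (j - m) * h (n - j))"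
  proof -
    have "conv c h (n - m) = (\<Sum>\<^sub>\<infinity>j. c (j - m) * h (n - j))" for m
      unfolding conv_def
      by (rule infsum_reindex_bij_witness[where i = "\<lambda>j. j - m" and j = "\<lambda>k. k + m"])
         (auto simp: algebra_simps)
    then show ?thesis
      unfolding conv_def[of d] by (simp add: mult.assoc infsum_cmult_right')
  qed
  also have "\<dots> = (\<Sum>\<^sub>\<infinity>j. \<Sum>\<^sub>\<infinity>m. d m * c (j - m) * h (n - j))"
    by (rule infsum_swap_banach, rule summable_on_conv_product[OF c d]) (rule h)
  also have "\<dots> = conv (conv d c) h n"
    by (simp add: conv_def infsum_cmult_left')
  finally show ?thesis .
qed

lemma conv_cis: "conv c (\<lambda>n. cis (of_int n * x)) n = fourier c x * cis (of_int n * x)"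
proof -
  have "conv c (\<lambda>n. cis (of_int n * x)) n = (\<Sum>\<^sub>\<infinity>m. c m * cis (- (of_int m * x)) * cis (of_int n * x))"
    unfolding conv_def by (intro infsum_cong) (simp add: cis_mult algebra_simps)
  then show ?thesis by (simp add: infsum_cmult_left' fourier_def)
qed

text \<open>Associativity is applied to the character with frequency x, an eigenvector of both
  convolutions, and evaluated at 0.\<close>

lemma fourier_conv:
  assumes "c summable_on UNIV" "d summable_on UNIV"
  shows "fourier (conv d c) x = fourier d x * fourier c x"
proof -
  define e where "e n = cis (of_int n * x)" for n
  have "fourier (conv d c) x = conv (conv d c) e 0"
    unfolding e_def by (simp add: conv_cis)
  also have "\<dots> = conv d (conv c e) 0"
    by (rule conv_conv[symmetric, where B = 1]) (auto simp: assms e_def)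
  also have "\<dots> = fourier c x * conv d e 0"
    unfolding conv_cis[of c x, folded e_def] conv_def[of d] infsum_cmult_right'[symmetric]
    by (simp add: mult_ac)
  also have "conv d e 0 = fourier d x" unfolding e_def by (simp add: conv_cis)
  finally show ?thesis by simp
qed

lemma fourier_uniform_limit:
  assumes "c summable_on UNIV"
  shows "uniform_limit A (\<lambda>X x. \<Sum>m\<in>X. c m * cis (- (of_int m * x))) (fourier c) (finite_subsets_at_top UNIV)"
  unfolding fourier_def[abs_def]
  by (rule Weierstrass_m_test_general[where M = "\<lambda>m. norm (c m)"])
     (use assms in \<open>auto simp: norm_mult summable_on_iff_abs_summable_on_complex\<close>)

lemma continuous_on_fourier:
  assumes "c summable_on UNIV"
  shows "continuous_on A (fourier c)"
  by (rule uniform_limit_theorem[OF _ fourier_uniform_limit[OF assms]])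
     (auto intro!: always_eventually continuous_intros)

lemma has_integral_cis:
  "((\<lambda>x. cis (of_int k * x)) has_integral (if k = 0 then 2 * pi else 0)) {-pi..pi}"
proof (cases "k = 0")
  case True
  have "((\<lambda>x. 1 :: complex) has_integral (pi - (- pi)) *\<^sub>R 1) {-pi..pi}"
    using has_integral_const_real[of "1 :: complex" "- pi" pi] by simp
  then show ?thesis using True by (simp add: scaleR_conv_of_real)
next
  case False
  define F where "F x = cis (of_int k * x) / (\<i> * of_int k)" for x
  have "((\<lambda>x. cis (of_int k * x)) has_integral (F pi - F (- pi))) {-pi..pi}"
  proof (rule fundamental_theorem_of_calculus)
    fix x :: real
    have "((\<lambda>z. exp (z * (\<i> * of_int k)) / (\<i> * of_int k)) has_field_derivative
      exp (of_real x * (\<i> * of_int k))) (at (of_real x))"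
      using False by (auto intro!: derivative_eq_intros)
    then have "((\<lambda>x. exp (of_real x * (\<i> * of_int k)) / (\<i> * of_int k)) has_vector_derivative
      exp (of_real x * (\<i> * of_int k))) (at x within {-pi..pi})"
      by (rule has_vector_derivative_real_field[OF has_field_derivative_at_within])
    then show "(F has_vector_derivative cis (of_int k * x)) (at x within {-pi..pi})"
      by (simp add: F_def[abs_def] cis_conv_exp mult_ac)
  qed simp
  moreover have "F pi = F (- pi)"
  proof -
    have "cis (of_int k * pi) = cis (- (of_int k * pi))"
      by (simp add: complex_eq_iff mult.commute[of _ pi])
    then show ?thesis by (simp add: F_def)
  qed
  ultimately show ?thesis using False by simp
qed

text \<open>Convergence is uniform, so the series may be multiplied by \<open>cis (j * x)\<close>
  and integrated. The integral of a finite partial sum is 2 pi times c j as soon as the index set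
  contains j.\<close>

lemma fourier_eq_0_imp_eq_0:
  assumes c: "c summable_on UNIV" and zero: "\<And>x. x \<in> {-pi..pi} \<Longrightarrow> fourier c x = 0"
  shows "c j = 0"
proof -
  let ?F = "finite_subsets_at_top (UNIV :: int set)"
  have "uniform_limit {-pi..pi} (\<lambda>X x. \<Sum>m\<in>X. c m * cis (- (of_int m * x))) (\<lambda>_. 0) ?F"
    using fourier_uniform_limit[OF c] by (rule uniform_limit_cong'[THEN iffD1, rotated 2]) (auto simp: zero)
  then have "uniform_limit {-pi..pi} (\<lambda>X x. (\<Sum>m\<in>X. c m * cis (- (of_int m * x))) * cis (of_int j * x)) (\<lambda>x. 0 * cis (of_int j * x)) ?F"
    by (intro uniform_lim_mult uniform_limit_const) (auto simp: bounded_iff intro!: exI[of _ 1])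
  then have "uniform_limit {-pi..pi} (\<lambda>X x. (\<Sum>m\<in>X. c m * cis (of_int (j - m) * x))) (\<lambda>x. 0) ?F"
    by (simp add: sum_distrib_right mult.assoc cis_mult left_diff_distrib)
  then obtain I J where IJ: "\<And>X. ((\<lambda>x. \<Sum>m\<in>X. c m * cis (of_int (j - m) * x)) has_integral I X) {-pi..pi}"
    "((\<lambda>x. 0) has_integral J) {-pi..pi}" "(I \<longlongrightarrow> J) ?F"
    by (rule uniform_limit_integral) (auto intro!: continuous_intros)
  have "J = 0" using IJ(2) by (rule has_integral_unique) simp
  have I: "I X = 2 * pi * c j" if "finite X" "j \<in> X" for X
  proof -
    have "((\<lambda>x. \<Sum>m\<in>X. c m * cis (of_int (j - m) * x)) has_integral
      (\<Sum>m\<in>X. c m * (if j - m = 0 then 2 * pi else 0))) {-pi..pi}"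
      using that has_integral_cis by (intro has_integral_sum has_integral_mult_right)
    then have "I X = (\<Sum>m\<in>X. c m * (if j - m = 0 then 2 * pi else 0))"
      using IJ(1) by (blast intro: has_integral_unique)
    also have "\<dots> = (\<Sum>m\<in>X. if m = j then 2 * pi * c j else 0)"
      by (intro sum.cong) auto
    finally show ?thesis using that by simp
  qed
  have "(I \<longlongrightarrow> 2 * pi * c j) ?F"
    by (rule tendsto_eventually)
       (auto simp: eventually_finite_subsets_at_top I intro!: exI[of _ "{j}"])
  then have "2 * pi * c j = 0"
    using IJ(3) \<open>J = 0\<close> tendsto_unique[of ?F] by force
  then show ?thesis by simp
qed

section \<open>Exponential decay and analytic continuation\<close>

lemma holomorphic_infsum:
  fixes f :: "'a \<Rightarrow> complex \<Rightarrow> complex"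
  assumes S: "open S" and f: "\<And>n. f n holomorphic_on S"
    and le: "\<And>n w. w \<in> S \<Longrightarrow> norm (f n w) \<le> M n" and M: "M summable_on UNIV"
  shows "(\<lambda>w. \<Sum>\<^sub>\<infinity>n. f n w) holomorphic_on S"
proof -
  let ?F = "finite_subsets_at_top (UNIV :: 'a set)"
  let ?g = "\<lambda>w. \<Sum>\<^sub>\<infinity>n. f n w"
  have "?g field_differentiable at z" if z: "z \<in> S" for z
  proof -
    obtain \<rho> where \<rho>: "\<rho> > 0" "cball z \<rho> \<subseteq> S" using S z by (meson open_contains_cball)
    have "uniform_limit (cball z \<rho>) (\<lambda>X w. \<Sum>n\<in>X. f n w) ?g ?F"
      using \<rho> le M by (intro Weierstrass_m_test_general[where M = M]) auto
    moreover have "(\<lambda>w. \<Sum>n\<in>X. f n w) holomorphic_on S" for X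
      by (intro holomorphic_on_sum f)
    then have "continuous_on (cball z \<rho>) (\<lambda>w. \<Sum>n\<in>X. f n w) \<and> (\<lambda>w. \<Sum>n\<in>X. f n w) holomorphic_on ball z \<rho>" for X
      using \<rho> ball_subset_cball by (meson holomorphic_on_imp_continuous_on holomorphic_on_subset)
    ultimately have "?g holomorphic_on ball z \<rho>"
      by (rule_tac holomorphic_uniform_limit[where F = ?F]) (auto intro: always_eventually)
    then show ?thesis
      using \<rho>(1) by (intro holomorphic_on_imp_differentiable_at[where s = "ball z \<rho>"]) auto
  qed
  then show ?thesis
    using field_differentiable_at_within holomorphic_on_def by blast
qed

lemma has_sum_int:
  fixes f :: "int \<Rightarrow> 'a::real_normed_vector"
  assumes "((\<lambda>k. f (int (Suc k))) has_sum A) UNIV" "((\<lambda>k. f (- int (Suc k))) has_sum B) UNIV"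
  shows "(f has_sum (f 0 + (A + B))) UNIV"
proof -
  have "(f has_sum A) {1..} \<longleftrightarrow> ((\<lambda>k. f (int (Suc k))) has_sum A) UNIV"
    by (rule has_sum_reindex_bij_witness[where i = "\<lambda>k. int (Suc k)" and j = "\<lambda>m. nat m - 1"]) auto
  moreover have "(f has_sum B) {..-1} \<longleftrightarrow> ((\<lambda>k. f (- int (Suc k))) has_sum B) UNIV"
    by (rule has_sum_reindex_bij_witness[where i = "\<lambda>k. - int (Suc k)" and j = "\<lambda>m. nat (- m) - 1"]) auto
  moreover have "(f has_sum f 0) {0}" by (rule has_sum_finiteI) auto
  ultimately have "(f has_sum (f 0 + (A + B))) ({0} \<union> ({1..} \<union> {..-1}))"
    using assms by (intro has_sum_Un_disjoint) auto
  also have "{0} \<union> ({1..} \<union> {..-1}) = (UNIV :: int set)" by auto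
  finally show ?thesis .
qed

lemma summable_on_nat_abs:
  fixes g :: "nat \<Rightarrow> real"
  assumes "summable g" "\<And>k. g k \<ge> 0"
  shows "(\<lambda>m::int. g (nat \<bar>m\<bar>)) summable_on UNIV"
proof -
  have "summable (\<lambda>k. g (Suc k))" using assms(1) by (subst summable_Suc_iff)
  then have hs: "((\<lambda>k. g (Suc k)) has_sum (\<Sum>k. g (Suc k))) UNIV"
    using assms(2) by (intro sums_nonneg_imp_has_sum) auto
  have eq: "nat \<bar>int (Suc k)\<bar> = Suc k" "nat \<bar>- int (Suc k)\<bar> = Suc k" for k
    by linarith+
  show ?thesis
    using has_sum_int[of "\<lambda>m. g (nat \<bar>m\<bar>)", unfolded eq, OF hs hs] by (rule has_sum_imp_summable)
qed

text \<open>The identity theorem on a strip around the real axis: an open real interval accumulates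
  at x0 inside the strip, although it has no interior in the complex plane.\<close>

lemma fourier_eq_0_if_decay:
  assumes r: "0 < r" "r < 1" and le: "\<And>n. norm (f n) \<le> B * r ^ nat \<bar>n\<bar>"
    and zero: "\<And>x. \<bar>x - x0\<bar> < \<epsilon> \<Longrightarrow> fourier f x = 0" and "\<epsilon> > 0"
  shows "fourier f x = 0"
proof -
  \<comment> \<open>Half of - ln r, the width up to which the terms decay. In this strip the growth
    of the exponential costs at most a factor making \<rho> the square root of r, which is still
    below 1.\<close>
  define \<delta> where "\<delta> = - ln r / 2"
  define \<rho> where "\<rho> = r * exp \<delta>"
  have \<delta>: "\<delta> > 0" using r by (simp add: \<delta>_def)
  have "\<rho> = exp (ln r / 2)"
    using r exp_add[of "ln r" \<delta>] by (simp add: \<rho>_def \<delta>_def)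
  then have \<rho>: "0 < \<rho>" "\<rho> < 1" using r by auto
  define S where "S = {w. \<bar>Im w\<bar> < \<delta>}"
  define F where "F w = (\<Sum>\<^sub>\<infinity>n. f n * exp (- (\<i> * of_int n * w)))" for w
  have F_real: "F (of_real x) = fourier f x" for x
    unfolding F_def fourier_def by (simp add: cis_conv_exp mult_ac)
  have S: "open S" "connected S"
  proof -
    have "S = {w. Im w < \<delta>} \<inter> {w. Im w > - \<delta>}" by (auto simp: S_def)
    then show "open S" "connected S"
      by (auto intro!: open_halfspace_Im_lt open_halfspace_Im_gt convex_connected
        convex_Int convex_halfspace_Im_lt convex_halfspace_Im_gt)
  qed
  have "F holomorphic_on S"
    unfolding F_def[abs_def]
  proof (rule holomorphic_infsum[OF S(1)])
    show "(\<lambda>w. f n * exp (- (\<i> * of_int n * w))) holomorphic_on S" for n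
      by (intro holomorphic_intros)
    show "(\<lambda>n. B * \<rho> ^ nat \<bar>n\<bar>) summable_on (UNIV :: int set)"
      using \<rho> by (intro summable_on_cmult_right summable_on_nat_abs summable_geometric) auto
    fix n w assume "w \<in> S"
    then have Im_w: "\<bar>Im w\<bar> \<le> \<delta>" by (simp add: S_def)
    have "of_int n * Im w \<le> \<bar>of_int n\<bar> * \<bar>Im w\<bar>"
      using abs_ge_self[of "of_int n * Im w"] by (simp only: abs_mult)
    also have "\<dots> \<le> \<bar>of_int n\<bar> * \<delta>" by (intro mult_left_mono Im_w) simp
    also have "\<dots> = of_nat (nat \<bar>n\<bar>) * \<delta>" by simp
    finally have "norm (exp (- (\<i> * of_int n * w))) \<le> exp \<delta> ^ nat \<bar>n\<bar>"
      by (simp flip: exp_of_nat_mult)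
    then have "norm (f n * exp (- (\<i> * of_int n * w))) \<le> (B * r ^ nat \<bar>n\<bar>) * exp \<delta> ^ nat \<bar>n\<bar>"
      unfolding norm_mult using order_trans[OF norm_ge_zero le] by (intro mult_mono le) auto
    then show "norm (f n * exp (- (\<i> * of_int n * w))) \<le> B * \<rho> ^ nat \<bar>n\<bar>"
      by (simp add: \<rho>_def power_mult_distrib mult.assoc)
  qed
  then have "F (of_real x) = 0"
  proof (rule analytic_continuation[OF _ S, where U = "of_real ` {x. \<bar>x - x0\<bar> < \<epsilon>}" and \<xi> = "of_real x0"])
    show "complex_of_real x0 islimpt of_real ` {x. \<bar>x - x0\<bar> < \<epsilon>}"
      unfolding islimpt_approachable
    proof (intro allI impI)
      fix e :: real assume "e > 0"
      define y where "y = x0 + min e \<epsilon> / 2"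
      have y: "y \<noteq> x0" "\<bar>y - x0\<bar> < e" "\<bar>y - x0\<bar> < \<epsilon>"
        using \<open>e > 0\<close> \<open>\<epsilon> > 0\<close> by (auto simp: y_def min_def)
      have "dist (complex_of_real y) (of_real x0) = \<bar>y - x0\<bar>"
        by (simp add: dist_norm flip: of_real_diff)
      with y show "\<exists>x'\<in>of_real ` {x. \<bar>x - x0\<bar> < \<epsilon>}. x' \<noteq> complex_of_real x0 \<and> dist x' (of_real x0) < e"
        by (intro bexI[of _ "complex_of_real y"]) auto
    qed
    show "F z = 0" if "z \<in> of_real ` {x. \<bar>x - x0\<bar> < \<epsilon>}" for z
      using that zero by (auto simp: F_real)
  qed (use \<delta> in \<open>auto simp: S_def\<close>)
  then show ?thesis by (simp add: F_real)
qed

text \<open>The sequence \<^term>\<open>d\<close> witnesses that the Fourier series of \<^term>\<open>c\<close> vanishes on an interval;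
  since \<^term>\<open>h\<close> is merely bounded, it has no Fourier series of its own, and convolving with
  \<^term>\<open>d\<close> replaces the product of Fourier series.\<close>

theorem conv_eq_0_if_decay:
  assumes c: "c summable_on UNIV" and d: "d summable_on UNIV" and h: "\<And>m. norm (h m) \<le> H"
    and cd: "\<And>x. x \<in> {-pi..pi} \<Longrightarrow> fourier d x * fourier c x = 0"
    and d0: "x0 \<in> {-pi..pi}" "fourier d x0 \<noteq> 0"
    and r: "0 < r" "r < 1" and le: "\<And>n. norm (conv c h n) \<le> B * r ^ nat \<bar>n\<bar>"
  shows "conv c h n = 0"
proof -
  define f where "f = conv c h"
  have "conv d c j = 0" for j
    by (rule fourier_eq_0_imp_eq_0[OF summable_on_conv[OF c d]]) (simp only: fourier_conv[OF c d] cd)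
  then have dc: "conv d c = (\<lambda>_. 0)" by (rule ext)
  have df: "conv d f n = 0" for n
    unfolding f_def conv_conv[OF c d, where h = h, OF h] dc by (simp add: conv_def)
  \<comment> \<open>Decay is used here for the first time: it makes f summable, so f has a Fourier
    series even though h has none. That series is then zero wherever the series of d is not, in
    particular near x0.\<close>
  have "(\<lambda>n. norm (f n)) summable_on UNIV"
  proof (rule Infinite_Sum.abs_summable_on_comparison_test')
    show "(\<lambda>n. B * r ^ nat \<bar>n\<bar>) summable_on (UNIV :: int set)"
      using r by (intro summable_on_cmult_right summable_on_nat_abs summable_geometric) auto
  qed (use le in \<open>simp add: f_def\<close>)
  then have f: "f summable_on UNIV" by (simp add: summable_on_iff_abs_summable_on_complex)
  have prod: "fourier d x * fourier f x = 0" for x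
    unfolding fourier_conv[OF f d, symmetric] by (simp add: fourier_def df)
  have "isCont (fourier d) x0"
    using continuous_on_fourier[OF d, of UNIV] by (simp add: continuous_on_eq_continuous_at)
  then obtain \<epsilon> where \<epsilon>: "\<epsilon> > 0" "\<And>x. \<bar>x - x0\<bar> < \<epsilon> \<Longrightarrow> fourier d x \<noteq> 0"
    using continuous_at_avoid[of x0 "fourier d" 0] d0(2) by (metis dist_real_def abs_minus_commute)
  have "fourier f x = 0" for x
  proof (rule fourier_eq_0_if_decay[OF r])
    show "norm (f n) \<le> B * r ^ nat \<bar>n\<bar>" for n using le by (simp add: f_def)
    show "fourier f x = 0" if "\<bar>x - x0\<bar> < \<epsilon>" for x
      using prod[of x] \<epsilon>(2)[OF that] by simp
  qed (rule \<epsilon>(1))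
  then have "f n = 0" by (intro fourier_eq_0_imp_eq_0[OF f])
  then show ?thesis by (simp add: f_def)
qed

section \<open>Absolutely convergent trapezoids\<close>

text \<open>In the series below the term for \<^term>\<open>n = 0\<close> is zero, since division by zero yields zero.\<close>

lemma summable_cos_over_square: "summable (\<lambda>n. \<bar>cos (real n * x) / (real n)\<^sup>2\<bar>)"
proof (rule summable_comparison_test')
  show "summable (\<lambda>n. inverse ((real n)\<^sup>2))"
    by (rule inverse_power_summable) simp
  show "norm \<bar>cos (real n * x) / (real n)\<^sup>2\<bar> \<le> inverse ((real n)\<^sup>2)" for n
    using mult_right_mono[OF abs_cos_le_one, of "inverse ((real n)\<^sup>2)" "real n * x"]
    by (simp add: abs_mult divide_inverse)
qed

text \<open>Polar form: 1 - cis t has modulus 2 sin (t / 2) and argument (t - pi) / 2, which lies in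
  the principal range for these t.\<close>

lemma Im_Ln_1_minus_cis:
  assumes "0 < t" "t < 2 * pi"
  shows "Im (Ln (1 - cis t)) = (t - pi) / 2"
proof -
  have s: "sin (t / 2) > 0" using assms by (intro sin_gt_zero) auto
  have "(t - pi) / 2 = t / 2 - pi / 2" by simp
  then have "cos ((t - pi) / 2) = sin (t / 2)" "sin ((t - pi) / 2) = - cos (t / 2)"
    by (simp_all only: cos_diff sin_diff) simp_all
  then have eq: "of_real (2 * sin (t / 2)) * cis ((t - pi) / 2) = 1 - cis t"
    using cos_double_sin[of "t / 2"] sin_double[of "t / 2"]
    by (simp add: complex_eq_iff power2_eq_square)
  then have "Arg (1 - cis t) = (t - pi) / 2"
    using s assms unfolding cis_conv_exp[of "(t - pi) / 2"]
    by (intro Arg_unique[of "2 * sin (t / 2)"]) auto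
  moreover have "1 - cis t \<noteq> 0"
    unfolding eq[symmetric] using s by simp
  ultimately show ?thesis by (simp add: Arg_eq_Im_Ln)
qed

text \<open>The integrand is minus the sum of \<open>\<rho> ^ n * sin (n * t) / n\<close>. Staying
  inside the unit disc makes the convergence uniform in t, hence integration term by term
  legitimate; at radius 1 uniformity fails near t = 0.\<close>

lemma integral_Im_Ln:
  assumes \<rho>: "0 \<le> \<rho>" "\<rho> < 1" and x: "0 \<le> x"
  shows "((\<lambda>t. Im (Ln (1 - of_real \<rho> * cis t))) has_integral
    (\<Sum>n. \<rho> ^ n * (cos (real n * x) / (real n)\<^sup>2)) - (\<Sum>n. \<rho> ^ n * (1 / (real n)\<^sup>2))) {0..x}"
proof -
  define f where "f n t = - (\<rho> ^ n * sin (real n * t) / real n)" for n t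
  have f_sums: "(\<lambda>n. f n t) sums Im (Ln (1 - of_real \<rho> * cis t))" for t
  proof -
    have "cmod (- (of_real \<rho> * cis t)) < 1" using \<rho> by (simp add: norm_mult)
    have "(of_real \<rho> * cis t) ^ n = of_real (\<rho> ^ n) * cis (real n * t)" for n
      by (simp add: power_mult_distrib Complex.DeMoivre)
    with sums_Im[OF Ln_series'[OF \<open>cmod _ < 1\<close>]] show ?thesis
      by (simp add: f_def Im_divide_of_nat)
  qed
  have cont: "continuous_on A (f n)" for A n
    by (cases "n = 0") (auto simp: f_def[abs_def] intro!: continuous_intros)
  have "uniform_limit {0..x} (\<lambda>N t. \<Sum>n<N. f n t) (\<lambda>t. \<Sum>n. f n t) sequentially"
  proof (rule Weierstrass_m_test)
    show "summable (\<lambda>n. \<rho> ^ n)" using \<rho> by simp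
    show "norm (f n t) \<le> \<rho> ^ n" for n t
    proof (cases "n = 0")
      case False
      then have "\<bar>sin (real n * t)\<bar> / real n \<le> 1 / 1"
        by (intro frac_le) auto
      then show ?thesis
        using mult_left_mono[of "\<bar>sin (real n * t)\<bar> / real n" 1 "\<rho> ^ n"] \<rho>
        by (simp add: f_def abs_mult)
    qed (simp add: f_def)
  qed
  then have "uniform_limit {0..x} (\<lambda>N t. \<Sum>n<N. f n t) (\<lambda>t. Im (Ln (1 - of_real \<rho> * cis t))) sequentially"
    using f_sums by (simp add: sums_iff)
  then obtain I J where IJ: "\<And>N. ((\<lambda>t. \<Sum>n<N. f n t) has_integral I N) {0..x}"
    "((\<lambda>t. Im (Ln (1 - of_real \<rho> * cis t))) has_integral J) {0..x}" "I \<longlonglongrightarrow> J"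
    by (rule uniform_limit_integral) (auto intro!: continuous_on_sum cont)
  have fI: "(f n has_integral (\<rho> ^ n * (cos (real n * x) / (real n)\<^sup>2) - \<rho> ^ n * (1 / (real n)\<^sup>2))) {0..x}" for n
  proof (cases "n = 0")
    case False
    define F where "F t = \<rho> ^ n * (cos (real n * t) / (real n)\<^sup>2)" for t
    have "(f n has_integral (F x - F 0)) {0..x}"
    proof (rule fundamental_theorem_of_calculus[OF x])
      fix t
      show "(F has_vector_derivative f n t) (at t within {0..x})"
        unfolding F_def[abs_def] f_def has_real_derivative_iff_has_vector_derivative[symmetric]
        using False by (auto intro!: derivative_eq_intros simp: power2_eq_square field_simps)
    qed
    then show ?thesis by (simp add: F_def)
  qed (simp add: f_def[abs_def])
  have "I N = (\<Sum>n<N. \<rho> ^ n * (cos (real n * x) / (real n)\<^sup>2) - \<rho> ^ n * (1 / (real n)\<^sup>2))" for N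
    by (rule has_integral_unique[OF IJ(1) has_integral_sum[OF finite_lessThan fI]])
  then have "I = (\<lambda>N. \<Sum>n<N. \<rho> ^ n * (cos (real n * x) / (real n)\<^sup>2) - \<rho> ^ n * (1 / (real n)\<^sup>2))" by (rule ext)
  with IJ(3) have "(\<lambda>n. \<rho> ^ n * (cos (real n * x) / (real n)\<^sup>2) - \<rho> ^ n * (1 / (real n)\<^sup>2)) sums J"
    unfolding sums_def by (simp only:)
  moreover have summ: "summable (\<lambda>n. \<rho> ^ n * (cos (real n * y) / (real n)\<^sup>2))" for y
  proof (rule summable_comparison_test'[OF summable_cos_over_square[of y]])
    show "norm (\<rho> ^ n * (cos (real n * y) / (real n)\<^sup>2)) \<le> \<bar>cos (real n * y) / (real n)\<^sup>2\<bar>" for n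
      unfolding real_norm_def abs_mult using \<rho> by (intro mult_left_le_one_le) (auto simp: power_abs power_le_one)
  qed
  ultimately have "J = (\<Sum>n. \<rho> ^ n * (cos (real n * x) / (real n)\<^sup>2)) - (\<Sum>n. \<rho> ^ n * (1 / (real n)\<^sup>2))"
    using suminf_diff[OF summ[of x] summ[of 0]]
    by (simp add: sums_iff)
  with IJ(2) show ?thesis by simp
qed

text \<open>Under absolute summability the power series converges uniformly on [0, 1], so Abel's
  limit is plain continuity at 1.\<close>

lemma abel_limit_abs_summable:
  fixes a :: "nat \<Rightarrow> real"
  assumes "summable (\<lambda>n. \<bar>a n\<bar>)"
  shows "(\<lambda>k. \<Sum>n. (real k / real (Suc k)) ^ n * a n) \<longlonglongrightarrow> (\<Sum>n. a n)"
proof -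
  have "uniform_limit {0..1} (\<lambda>N \<rho>. \<Sum>n<N. \<rho> ^ n * a n) (\<lambda>\<rho>. \<Sum>n. \<rho> ^ n * a n) sequentially"
    by (rule Weierstrass_m_test[OF _ assms])
       (auto simp: abs_mult power_abs intro!: mult_left_le_one_le power_le_one)
  then have "continuous_on {0..1} (\<lambda>\<rho>. \<Sum>n. \<rho> ^ n * a n)"
    by (rule uniform_limit_theorem[rotated]) (auto intro!: always_eventually continuous_intros)
  then have "(\<lambda>k. \<Sum>n. (real k / real (Suc k)) ^ n * a n) \<longlonglongrightarrow> (\<Sum>n. 1 ^ n * a n)"
    by (rule continuous_on_tendsto_compose[where f = "\<lambda>\<rho>. \<Sum>n. \<rho> ^ n * a n"])
       (auto intro!: always_eventually LIMSEQ_n_over_Suc_n simp del: of_nat_Suc)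
  then show ?thesis by simp
qed

text \<open>The radius tends to 1 on both sides of \<open>integral_Im_Ln\<close>: the series by
  Abel's limit, the integrals by dominated convergence with the bound pi for an imaginary part of
  \<open>Ln\<close>. The sum of 1 / n^2 stays unevaluated because it cancels in the
  trapezoid.\<close>

theorem cos_over_square_sums:
  assumes x: "0 \<le> x" "x \<le> 2 * pi"
  shows "(\<Sum>n. cos (real n * x) / (real n)\<^sup>2) = (\<Sum>n. 1 / (real n)\<^sup>2) - pi * x / 2 + x\<^sup>2 / 4"
proof -
  define \<rho> where "\<rho> k = real k / real (Suc k)" for k
  have \<rho>: "0 \<le> \<rho> k" "\<rho> k < 1" "\<rho> \<longlonglongrightarrow> 1" for k
    using LIMSEQ_n_over_Suc_n[where 'a = real] by (simp_all add: \<rho>_def[abs_def])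
  \<comment> \<open>At t = 0 and t = 2 pi the logarithm is taken of the positive real 1 - \<rho>, so
    its imaginary part is 0 for every radius. The integral does not see these two points.\<close>
  define g where "g t = (if t = 0 \<or> t = 2 * pi then 0 else (t - pi) / 2)" for t
  define f where "f k t = Im (Ln (1 - of_real (\<rho> k) * cis t))" for k t
  have re_pos: "Re (1 - of_real (\<rho> k) * cis t) > 0" for k t
  proof -
    have "\<rho> k * cos t \<le> \<rho> k * 1" using \<rho> by (intro mult_left_mono) auto
    also have "\<dots> < 1" using \<rho> by simp
    finally show ?thesis by simp
  qed
  have f_lim: "(\<lambda>k. f k t) \<longlonglongrightarrow> g t" if t: "t \<in> {0..x}" for t
  proof (cases "t = 0 \<or> t = 2 * pi")
    case True
    then have "cis t = 1" by (auto simp: complex_eq_iff)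
    then have "f k t = Im (Ln (of_real (1 - \<rho> k)))" for k by (simp add: f_def)
    then have "f k t = 0" for k using \<rho>(2)[of k] by (simp only: Ln_of_real) simp
    then show ?thesis using True by (simp add: g_def)
  next
    case False
    then have t': "0 < t" "t < 2 * pi" using t x by auto
    have "cos t < 1"
      using t' cos_double_sin[of "t / 2"] sin_gt_zero[of "t / 2"] by simp
    then have "1 - cis t \<notin> \<real>\<^sub>\<le>\<^sub>0" by (auto simp: complex_nonpos_Reals_iff)
    moreover have "(\<lambda>k. 1 - of_real (\<rho> k) * cis t) \<longlonglongrightarrow> 1 - of_real 1 * cis t"
      by (intro tendsto_intros \<rho>)
    ultimately have "(\<lambda>k. f k t) \<longlonglongrightarrow> Im (Ln (1 - of_real 1 * cis t))"
      unfolding f_def by (intro tendsto_Im tendsto_Ln) auto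
    then show ?thesis using False Im_Ln_1_minus_cis[OF t'] by (simp add: g_def)
  qed
  have f_le: "norm (f k t) \<le> pi" for k t
  proof -
    have "1 - of_real (\<rho> k) * cis t \<noteq> 0" using re_pos[of k t] by force
    from mpi_less_Im_Ln[OF this] Im_Ln_le_pi[OF this] show ?thesis by (simp add: f_def abs_le_iff)
  qed
  have f_int: "(f k has_integral (\<Sum>n. \<rho> k ^ n * (cos (real n * x) / (real n)\<^sup>2)) - (\<Sum>n. \<rho> k ^ n * (1 / (real n)\<^sup>2))) {0..x}" for k
    unfolding f_def by (rule integral_Im_Ln[OF \<rho>(1,2) x(1)])
  have lim_g: "(\<lambda>k. integral {0..x} (f k)) \<longlonglongrightarrow> integral {0..x} g"
    using f_int f_le f_lim by (intro dominated_convergence(2)[where h = "\<lambda>_. pi"]) auto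
  have int_g: "integral {0..x} g = x\<^sup>2 / 4 - pi * x / 2"
  proof (rule integral_unique)
    have "((\<lambda>t. (t - pi) / 2) has_integral ((x\<^sup>2 / 4 - pi * x / 2) - (0\<^sup>2 / 4 - pi * 0 / 2))) {0..x}"
      using x(1) by (intro fundamental_theorem_of_calculus)
        (auto intro!: derivative_eq_intros simp: has_real_derivative_iff_has_vector_derivative[symmetric] field_simps)
    then show "(g has_integral x\<^sup>2 / 4 - pi * x / 2) {0..x}"
      by (rule has_integral_spike_finite[of "{0, 2 * pi}", rotated 2, OF has_integral_eq_rhs])
         (auto simp: g_def)
  qed
  have lim_S: "(\<lambda>k. integral {0..x} (f k)) \<longlonglongrightarrow> (\<Sum>n. cos (real n * x) / (real n)\<^sup>2) - (\<Sum>n. 1 / (real n)\<^sup>2)"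
    unfolding integral_unique[OF f_int] \<rho>_def
    using summable_cos_over_square[of x] summable_cos_over_square[of 0]
    by (intro tendsto_diff abel_limit_abs_summable) simp_all
  show ?thesis using LIMSEQ_unique[OF lim_S lim_g] int_g by simp
qed

text \<open>The cosine series S is, near 0, a constant plus a parabola minus pi |y| / 2. In the
  signed sum of its shifts by \<plusminus> a and \<plusminus> b the constants cancel, the parabolas
  leave the constant - (b^2 - a^2) / 2, and the kinks leave a trapezoid of height (b - a)
  pi.\<close>

theorem trapezoid_exists:
  assumes ab: "0 < a" "a < b" "b < pi"
  obtains c :: "int \<Rightarrow> real" where "c summable_on UNIV"
    "\<And>x. \<bar>x\<bar> \<le> a \<Longrightarrow> fourier (\<lambda>m. of_real (c m)) x = 1"
    "\<And>x. b \<le> \<bar>x\<bar> \<Longrightarrow> \<bar>x\<bar> \<le> pi \<Longrightarrow> fourier (\<lambda>m. of_real (c m)) x = 0"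
proof -
  define N where "N = (b - a) * pi"
  have N: "N > 0" using ab by (simp add: N_def)
  \<comment> \<open>Shifting a cosine series by \<plusminus> a and adding multiplies its n-th
    coefficient by 2 cos (n a). The term e restores the zero level, and N scales the plateau to
    1.\<close>
  define G where "G n = (cos (real n * a) - cos (real n * b)) / (real n)\<^sup>2" for n
  define e where "e m = (if m = 0 then (b\<^sup>2 - a\<^sup>2) / 2 else 0)" for m :: int
  define c where "c m = (G (nat \<bar>m\<bar>) + e m) / N" for m
  define S where "S x = (\<Sum>n. cos (real n * x) / (real n)\<^sup>2)" for x
  have summ: "summable (\<lambda>n. cos (real n * x) / (real n)\<^sup>2)" for x
    by (rule summable_rabs_cancel[OF summable_cos_over_square])
  have summ_G: "summable (\<lambda>n. \<bar>G n\<bar>)"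
  proof (rule summable_comparison_test')
    show "summable (\<lambda>n. \<bar>cos (real n * a) / (real n)\<^sup>2\<bar> + \<bar>cos (real n * b) / (real n)\<^sup>2\<bar>)"
      by (intro summable_add summable_cos_over_square)
    show "norm \<bar>G n\<bar> \<le> \<bar>cos (real n * a) / (real n)\<^sup>2\<bar> + \<bar>cos (real n * b) / (real n)\<^sup>2\<bar>" for n
      unfolding G_def diff_divide_distrib real_norm_def abs_idempotent by (rule abs_triangle_ineq4)
  qed
  have "(\<lambda>m. \<bar>G (nat \<bar>m\<bar>)\<bar>) summable_on (UNIV :: int set)"
    by (rule summable_on_nat_abs[OF summ_G]) simp
  then have "(\<lambda>m. G (nat \<bar>m\<bar>)) summable_on (UNIV :: int set)"
    by (subst summable_on_iff_abs_summable_on_real) simp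
  moreover have "e summable_on UNIV"
    by (rule finite_nonzero_values_imp_summable_on) (simp add: e_def)
  ultimately have c: "c summable_on UNIV"
    unfolding c_def[abs_def] divide_inverse by (intro summable_on_cmult_left summable_on_add)
  have T_sums: "(\<lambda>n. G n * (2 * cos (real n * x))) sums (S (x - a) + S (x + a) - S (x - b) - S (x + b))" for x
  proof -
    have "(\<lambda>n. cos (real n * (x - a)) / (real n)\<^sup>2 + cos (real n * (x + a)) / (real n)\<^sup>2
        - cos (real n * (x - b)) / (real n)\<^sup>2 - cos (real n * (x + b)) / (real n)\<^sup>2) sums
      (S (x - a) + S (x + a) - S (x - b) - S (x + b))"
      unfolding S_def by (intro sums_diff sums_add summable_sums summ)
    moreover have "cos (real n * (x - a)) / (real n)\<^sup>2 + cos (real n * (x + a)) / (real n)\<^sup>2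
        - cos (real n * (x - b)) / (real n)\<^sup>2 - cos (real n * (x + b)) / (real n)\<^sup>2 =
      G n * (2 * cos (real n * x))" for n
      unfolding G_def distrib_left right_diff_distrib cos_add cos_diff
      by (simp add: add_divide_distrib diff_divide_distrib algebra_simps)
    ultimately show ?thesis by simp
  qed
  have fourier: "fourier (\<lambda>m. of_real (c m)) x =
    of_real (((b\<^sup>2 - a\<^sup>2) / 2 + (S (x - a) + S (x + a) - S (x - b) - S (x + b))) / N)" for x
  proof -
    let ?u = "\<lambda>m. complex_of_real (c m) * cis (- (of_int m * x))"
    have u: "?u summable_on UNIV"
      by (rule summable_on_mult_bounded[where B = 1]) (use c summable_on_of_real in auto)
    have half: "(\<lambda>k. ?u (int (Suc k))) summable_on UNIV" "(\<lambda>k. ?u (- int (Suc k))) summable_on UNIV"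
      using summable_on_reindex[of "\<lambda>k. int (Suc k)" UNIV ?u] summable_on_reindex[of "\<lambda>k. - int (Suc k)" UNIV ?u]
        summable_on_subset_banach[OF u] by (auto simp: inj_def o_def)
    \<comment> \<open>The coefficients are even, so the terms of m and - m combine into a cosine and
      the two-sided sum becomes the one-sided series of \<open>T_sums\<close>.\<close>
    have "((\<lambda>k. ?u (int (Suc k)) + ?u (- int (Suc k))) has_sum
      ((\<Sum>\<^sub>\<infinity>k. ?u (int (Suc k))) + (\<Sum>\<^sub>\<infinity>k. ?u (- int (Suc k))))) UNIV"
      using half by (intro has_sum_add has_sum_infsum)
    then have "(\<lambda>k. ?u (int (Suc k)) + ?u (- int (Suc k))) sums
      ((\<Sum>\<^sub>\<infinity>k. ?u (int (Suc k))) + (\<Sum>\<^sub>\<infinity>k. ?u (- int (Suc k))))"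
      by (rule has_sum_imp_sums)
    moreover have "?u (int (Suc k)) + ?u (- int (Suc k)) = of_real (G (Suc k) * (2 * cos (real (Suc k) * x)) / N)" for k
    proof -
      have "c (int (Suc k)) = G (Suc k) / N" "c (- int (Suc k)) = G (Suc k) / N"
        by (simp_all add: c_def e_def nat_add_distrib)
      moreover have "cis (- (of_int (- int (Suc k)) * x)) = cis (real (Suc k) * x)"
        "cis (- (of_int (int (Suc k)) * x)) = cis (- (real (Suc k) * x))"
        by (simp_all only: of_int_minus of_int_of_nat_eq mult_minus_left minus_minus)
      ultimately show ?thesis
        by (simp only:) (simp add: complex_eq_iff del: of_nat_Suc)
    qed
    \<comment> \<open>Starting at index 1 loses nothing, as \<open>G 0\<close> is zero; the
      coefficient c 0 comes from e alone.\<close>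
    moreover have "(\<lambda>k. complex_of_real (G (Suc k) * (2 * cos (real (Suc k) * x)) / N)) sums
      of_real ((S (x - a) + S (x + a) - S (x - b) - S (x + b)) / N)"
      using T_sums[of x] sums_Suc_iff[of "\<lambda>n. G n * (2 * cos (real n * x))"]
      by (intro sums_of_real sums_divide) (simp add: G_def[of 0])
    ultimately have "(\<Sum>\<^sub>\<infinity>k. ?u (int (Suc k))) + (\<Sum>\<^sub>\<infinity>k. ?u (- int (Suc k))) =
      of_real ((S (x - a) + S (x + a) - S (x - b) - S (x + b)) / N)"
      by (simp only: sums_unique2)
    moreover have "fourier (\<lambda>m. of_real (c m)) x = ?u 0 + ((\<Sum>\<^sub>\<infinity>k. ?u (int (Suc k))) + (\<Sum>\<^sub>\<infinity>k. ?u (- int (Suc k))))"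
      unfolding fourier_def
      by (rule infsumI, rule has_sum_int[where f = ?u]) (use half in \<open>simp_all only: has_sum_infsum\<close>)
    ultimately show ?thesis
      by (simp add: c_def e_def G_def add_divide_distrib)
  qed
  define B where "B y = (\<Sum>n. 1 / (real n)\<^sup>2) - pi * y / 2 + y\<^sup>2 / 4" for y
  \<comment> \<open>The closed form reaches only up to 2 pi; for |x| \<le> pi and b < pi all four
    shifted arguments stay in this range.\<close>
  have S: "S y = B \<bar>y\<bar>" if "\<bar>y\<bar> \<le> 2 * pi" for y
  proof -
    have "S y = S \<bar>y\<bar>" unfolding S_def by (cases "y \<ge> 0") auto
    then show ?thesis using cos_over_square_sums[of "\<bar>y\<bar>"] that by (simp add: S_def B_def)
  qed
  have val: "S (x - a) + S (x + a) - S (x - b) - S (x + b) =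
    B \<bar>x - a\<bar> + B \<bar>x + a\<bar> - B \<bar>x - b\<bar> - B \<bar>x + b\<bar>" if "\<bar>x\<bar> \<le> pi" for x
    using that ab by (subst (1 2 3 4) S) auto
  have inner: "B \<bar>x - a\<bar> + B \<bar>x + a\<bar> - B \<bar>x - b\<bar> - B \<bar>x + b\<bar> = N - (b\<^sup>2 - a\<^sup>2) / 2" if "\<bar>x\<bar> \<le> a" for x
  proof -
    have "\<bar>x - a\<bar> = a - x" "\<bar>x + a\<bar> = x + a" "\<bar>x - b\<bar> = b - x" "\<bar>x + b\<bar> = x + b" using that ab by auto
    then show ?thesis by (simp add: B_def N_def power2_eq_square field_simps)
  qed
  have outer: "B \<bar>x - a\<bar> + B \<bar>x + a\<bar> - B \<bar>x - b\<bar> - B \<bar>x + b\<bar> = - (b\<^sup>2 - a\<^sup>2) / 2" if "b \<le> \<bar>x\<bar>" for x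
  proof (cases "x \<ge> 0")
    case True
    then have "\<bar>x - a\<bar> = x - a" "\<bar>x + a\<bar> = x + a" "\<bar>x - b\<bar> = x - b" "\<bar>x + b\<bar> = x + b" using that ab by auto
    then show ?thesis by (simp add: B_def N_def power2_eq_square field_simps)
  next
    case False
    then have "\<bar>x - a\<bar> = a - x" "\<bar>x + a\<bar> = - x - a" "\<bar>x - b\<bar> = b - x" "\<bar>x + b\<bar> = - x - b" using that ab by auto
    then show ?thesis by (simp add: B_def N_def power2_eq_square field_simps)
  qed
  show thesis
  proof
    show "c summable_on UNIV" by (rule c)
    have "a \<le> pi" using ab by simp
    then show "fourier (\<lambda>m. of_real (c m)) x = 1" if "\<bar>x\<bar> \<le> a" for x
      unfolding fourier val[OF order_trans[OF that \<open>a \<le> pi\<close>]] inner[OF that] using N by simp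
    show "fourier (\<lambda>m. of_real (c m)) x = 0" if "b \<le> \<bar>x\<bar>" "\<bar>x\<bar> \<le> pi" for x
      unfolding fourier val[OF that(2)] outer[OF that(1)] by (simp add: diff_divide_distrib)
  qed
qed

section \<open>The generators\<close>

lemma summable_on_product_nonneg:
  fixes f :: "'a \<Rightarrow> real" and g :: "'b \<Rightarrow> real"
  assumes f: "f summable_on UNIV" "\<And>x. f x \<ge> 0" and g: "g summable_on UNIV" "\<And>y. g y \<ge> 0"
  shows "(\<lambda>(x, y). f x * g y) summable_on UNIV \<times> UNIV"
proof (rule summable_on_SigmaI)
  show "((\<lambda>y. case (x, y) of (x, y) \<Rightarrow> f x * g y) has_sum f x * infsum g UNIV) UNIV" for x
    using g by (auto intro!: has_sum_cmult_right)
  show "(\<lambda>x. f x * infsum g UNIV) summable_on UNIV"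
    using f by (intro summable_on_cmult_left)
qed (use f g in auto)

text \<open>With + m in the argument, the translate by n + s involves the Gaussians centred at n - m
  + s, so that L of it is a convolution in n.\<close>

definition generator :: "(int \<Rightarrow> real) \<Rightarrow> real \<Rightarrow> real" where
  "generator c t = (\<Sum>\<^sub>\<infinity>m. c m * std_normal_density (t + of_int m))"

lemma std_normal_density_le_1: "std_normal_density x \<le> 1"
proof -
  have "sqrt (2 * pi) \<ge> sqrt 1" using pi_gt3 by (intro real_sqrt_le_mono) simp
  then have "1 / sqrt (2 * pi) * exp (- x\<^sup>2 / 2) \<le> 1 * 1"
    by (intro mult_mono) auto
  then show ?thesis by (simp add: std_normal_density_def)
qed

text \<open>Enumerates the integers, as \<open>l1_functional.sums\<close> deals with series indexed
  by naturals.\<close>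

lemma sums_int_decode:
  fixes f :: "int \<Rightarrow> real"
  assumes "f summable_on UNIV"
  shows "summable (\<lambda>k. \<bar>f (int_decode k)\<bar>)" "(\<lambda>k. f (int_decode k)) sums (\<Sum>\<^sub>\<infinity>m. f m)"
proof -
  have bij: "bij_betw int_decode UNIV UNIV" by (rule bij_int_decode)
  have "(f has_sum (\<Sum>\<^sub>\<infinity>m. f m)) UNIV" using assms by simp
  then have "((\<lambda>k. f (int_decode k)) has_sum (\<Sum>\<^sub>\<infinity>m. f m)) UNIV"
    by (subst has_sum_reindex_bij_betw[OF bij])
  then show "(\<lambda>k. f (int_decode k)) sums (\<Sum>\<^sub>\<infinity>m. f m)" by (rule has_sum_imp_sums)
  have "(\<lambda>m. norm (f m)) summable_on UNIV"
    using assms by (subst (asm) summable_on_iff_abs_summable_on_real)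
  then have "(\<lambda>k. norm (f (int_decode k))) summable_on UNIV"
    by (subst summable_on_reindex_bij_betw[OF bij])
  then show "summable (\<lambda>k. \<bar>f (int_decode k)\<bar>)"
    by (simp add: summable_on_imp_summable)
qed

lemma summable_on_mult_bounded_real:
  fixes c h :: "'a \<Rightarrow> real"
  assumes c: "c summable_on UNIV" and h: "\<And>m. \<bar>h m\<bar> \<le> B"
  shows "(\<lambda>m. c m * h m) summable_on UNIV" and "\<bar>\<Sum>\<^sub>\<infinity>m. c m * h m\<bar> \<le> (\<Sum>\<^sub>\<infinity>m. \<bar>c m\<bar>) * B"
proof -
  have c': "(\<lambda>m. \<bar>c m\<bar> * B) summable_on UNIV"
    using c by (subst (asm) summable_on_iff_abs_summable_on_real) (auto intro: summable_on_cmult_left)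
  have le: "\<bar>c m * h m\<bar> \<le> \<bar>c m\<bar> * B" for m
    by (simp add: abs_mult mult_left_mono h)
  have abs: "(\<lambda>m. norm (c m * h m)) summable_on UNIV"
    by (rule Infinite_Sum.abs_summable_on_comparison_test'[OF c']) (use le in simp)
  then show "(\<lambda>m. c m * h m) summable_on UNIV"
    by (subst summable_on_iff_abs_summable_on_real)
  have "\<bar>\<Sum>\<^sub>\<infinity>m. c m * h m\<bar> \<le> (\<Sum>\<^sub>\<infinity>m. norm (c m * h m))"
    using norm_infsum_bound[OF abs] by simp
  also have "\<dots> \<le> (\<Sum>\<^sub>\<infinity>m. \<bar>c m\<bar> * B)"
    using le by (intro infsum_mono abs c') auto
  finally show "\<bar>\<Sum>\<^sub>\<infinity>m. c m * h m\<bar> \<le> (\<Sum>\<^sub>\<infinity>m. \<bar>c m\<bar>) * B"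
    by (simp add: infsum_cmult_left')
qed

lemma integrable_density_shift: "integrable lborel (\<lambda>t. std_normal_density (t + x))"
  and integral_density_shift: "(\<integral>t. std_normal_density (t + x) \<partial>lborel) = 1"
  using integrable_power_density(1)[of "- x" 0] integral_power_density[of "- x" 0]
    integrable_std_normal_moment[of 0]
  by (simp_all add: moment_def)

text \<open>Each Gaussian translate has L^1 norm 1, so the m-th term has norm |c m| and the series
  converges absolutely in L^1.\<close>

lemma (in l1_functional) generator_translate:
  assumes c: "c summable_on UNIV"
  shows "integrable lborel (\<lambda>t. generator c (t - x))"
    and "L (\<lambda>t. generator c (t - x)) = (\<Sum>\<^sub>\<infinity>m. c m * L (\<lambda>t. std_normal_density (t - x + of_int m)))"
proof -
  define f where "f k t = c (int_decode k) * std_normal_density (t - x + of_int (int_decode k))" for k t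
  have gen: "generator c (t - x) = (\<Sum>k. f k t)" and summ: "summable (\<lambda>k. \<bar>f k t\<bar>)" for t
  proof -
    have "(\<lambda>m. c m * std_normal_density (t - x + of_int m)) summable_on UNIV"
      by (rule summable_on_mult_bounded_real(1)[OF c, of _ 1]) (simp add: std_normal_density_le_1)
    from sums_int_decode[OF this]
    show "generator c (t - x) = (\<Sum>k. f k t)" "summable (\<lambda>k. \<bar>f k t\<bar>)"
      by (simp_all add: generator_def f_def sums_iff)
  qed
  have shift: "integrable lborel (\<lambda>t. std_normal_density (t - x + of_int m))"
    "(\<integral>t. std_normal_density (t - x + of_int m) \<partial>lborel) = 1" for m
    using integrable_density_shift[of "of_int m - x"] integral_density_shift[of "of_int m - x"]
    by (simp_all add: algebra_simps)
  have f_int: "integrable lborel (f k)" for k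
    unfolding f_def by (intro integrable_mult_right shift)
  have "(\<integral>t. \<bar>f k t\<bar> \<partial>lborel) = \<bar>c (int_decode k)\<bar>" for k
    by (simp add: f_def abs_mult shift)
  then have summ_int: "summable (\<lambda>k. \<integral>t. \<bar>f k t\<bar> \<partial>lborel)"
    using sums_int_decode(1)[OF c] by simp
  show "integrable lborel (\<lambda>t. generator c (t - x))"
    unfolding gen by (rule sums(1)[OF f_int summ summ_int])
  have "L (f k) = c (int_decode k) * L (\<lambda>t. std_normal_density (t - x + of_int (int_decode k)))" for k
    unfolding f_def by (intro scale shift)
  then have "(\<lambda>k. c (int_decode k) * L (\<lambda>t. std_normal_density (t - x + of_int (int_decode k)))) sums
      L (\<lambda>t. generator c (t - x))"
    using sums(2)[OF f_int summ summ_int] unfolding gen by simp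
  moreover have "(\<lambda>m. c m * L (\<lambda>t. std_normal_density (t - x + of_int m))) summable_on UNIV"
    using bound[OF shift(1)] shift(2)
    by (intro summable_on_mult_bounded_real(1)[OF c, of _ 1]) simp
  then have "(\<lambda>k. c (int_decode k) * L (\<lambda>t. std_normal_density (t - x + of_int (int_decode k)))) sums
      (\<Sum>\<^sub>\<infinity>m. c m * L (\<lambda>t. std_normal_density (t - x + of_int m)))"
    by (rule sums_int_decode(2))
  ultimately show "L (\<lambda>t. generator c (t - x)) = (\<Sum>\<^sub>\<infinity>m. c m * L (\<lambda>t. std_normal_density (t - x + of_int m)))"
    by (rule sums_unique2)
qed

lemma integrable_generator:
  assumes "c summable_on UNIV"
  shows "integrable lborel (\<lambda>t. generator c (t - x))"
proof -
  \<comment> \<open>The zero functional opens the locale, to reach its statement about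
    integrability.\<close>
  interpret l1_functional "\<lambda>_. 0" by standard auto
  show ?thesis by (rule generator_translate(1)[OF assms])
qed

section \<open>Taylor coefficients of a functional along translates\<close>

context l1_functional
begin

text \<open>This is h_k of the overview.\<close>

definition taylor :: "nat \<Rightarrow> int \<Rightarrow> real" where
  "taylor k j = L (\<lambda>y. (y - of_int j) ^ k * std_normal_density (y - of_int j)) / fact k"

text \<open>This is f_k of the overview, kept real; it becomes a \<open>conv\<close> only when the
  Fourier argument needs complex sequences.\<close>

definition gen_taylor :: "(int \<Rightarrow> real) \<Rightarrow> nat \<Rightarrow> int \<Rightarrow> real" where
  "gen_taylor c k n = (\<Sum>\<^sub>\<infinity>m. c m * taylor k (n - m))"

lemma abs_taylor_le: "\<bar>taylor k j\<bar> \<le> moment k"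
proof -
  have "\<bar>taylor k j\<bar> \<le> (\<integral>y. \<bar>(y - of_int j) ^ k * std_normal_density (y - of_int j)\<bar> \<partial>lborel) / fact k"
    unfolding taylor_def abs_divide
    using bound[OF integrable_power_density(1)[of "of_int j" k]] by (simp add: divide_right_mono)
  also have "\<dots> = moment k"
    unfolding integral_power_density[of "of_int j" k, symmetric] by (simp add: abs_mult power_abs)
  finally show ?thesis .
qed

text \<open>With u = y - j, the exponential series of s u times the density is
  \<open>exp (s\<^sup>2 / 2)\<close> times the density centred at j + s, again by completing the
  square.\<close>

lemma taylor_sums:
  "(\<lambda>k. s ^ k * taylor k j) sums (exp (s\<^sup>2 / 2) * L (\<lambda>y. std_normal_density (y - of_int j - s)))"
proof -
  have "(\<lambda>k. 1 / fact k * s ^ k * L (\<lambda>y. (y - of_int j) ^ k * std_normal_density (y - of_int j))) sums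
    L (\<lambda>y. (\<Sum>k. 1 / fact k * (s * (y - of_int j)) ^ k) * std_normal_density (y - of_int j))"
    by (rule power_series_density) simp
  also have "(\<lambda>y. (\<Sum>k. 1 / fact k * (s * (y - of_int j)) ^ k) * std_normal_density (y - of_int j)) =
    (\<lambda>y. exp (s\<^sup>2 / 2) * std_normal_density (y - of_int j - s))"
  proof
    fix y :: real
    define u where "u = y - of_int j"
    have "(\<Sum>k. 1 / fact k * (s * u) ^ k) = exp (s * u)"
      using exp_converges[of "s * u"] by (simp add: sums_iff scaleR_conv_of_real divide_inverse)
    moreover have "exp (s * u) * exp (- u\<^sup>2 / 2) = exp (s\<^sup>2 / 2) * exp (- (u - s)\<^sup>2 / 2)"
      unfolding exp_add[symmetric] by (simp add: power2_eq_square field_simps)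
    ultimately show "(\<Sum>k. 1 / fact k * (s * (y - of_int j)) ^ k) * std_normal_density (y - of_int j) =
      exp (s\<^sup>2 / 2) * std_normal_density (y - of_int j - s)"
      by (simp add: std_normal_density_def flip: u_def)
  qed
  also have "L (\<lambda>y. exp (s\<^sup>2 / 2) * std_normal_density (y - of_int j - s)) =
    exp (s\<^sup>2 / 2) * L (\<lambda>y. std_normal_density (y - of_int j - s))"
    using integrable_density_shift[of "- of_int j - s"] by (intro scale) (simp add: algebra_simps)
  finally show ?thesis by (simp add: taylor_def)
qed

lemma gen_taylor_le:
  assumes "c summable_on UNIV"
  shows "\<bar>gen_taylor c k n\<bar> \<le> (\<Sum>\<^sub>\<infinity>m. \<bar>c m\<bar>) * moment k"
  unfolding gen_taylor_def by (rule summable_on_mult_bounded_real(2)[OF assms abs_taylor_le])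

lemma gen_taylor_sums:
  assumes c: "c summable_on UNIV"
  shows "(\<lambda>k. s ^ k * gen_taylor c k n) sums (exp (s\<^sup>2 / 2) * L (\<lambda>t. generator c (t - (of_int n + s))))"
proof -
  have c': "(\<lambda>m. \<bar>c m\<bar>) summable_on UNIV"
    using c by (subst (asm) summable_on_iff_abs_summable_on_real) simp
  have mom: "(\<lambda>k. \<bar>s\<bar> ^ k * moment k) summable_on UNIV"
    using summable_moment[of "\<bar>s\<bar>"] moment_nonneg
    by (intro norm_summable_imp_summable_on) (simp add: abs_mult)
  have taylor_le: "\<bar>s ^ k * taylor k j\<bar> \<le> \<bar>s\<bar> ^ k * moment k" for k j
    by (simp add: abs_mult power_abs mult_left_mono abs_taylor_le)
  \<comment> \<open>A majorant that is a product of two summable families, uniform in n; it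
    justifies exchanging the sum over m with the Taylor series.\<close>
  have "(\<lambda>(m, k). \<bar>c m\<bar> * (\<bar>s\<bar> ^ k * moment k)) summable_on UNIV \<times> UNIV"
    by (rule summable_on_product_nonneg[OF c' _ mom]) (auto simp: moment_nonneg)
  then have "(\<lambda>p. norm (case p of (m, k) \<Rightarrow> c m * (s ^ k * taylor k (n - m)))) summable_on UNIV \<times> UNIV"
    by (rule Infinite_Sum.abs_summable_on_comparison_test')
       (auto simp only: split_paired_all prod.case real_norm_def abs_mult[of "c _"] intro!: mult_left_mono taylor_le)
  then have prod: "(\<lambda>(m, k). c m * (s ^ k * taylor k (n - m))) summable_on UNIV \<times> UNIV"
    by (subst summable_on_iff_abs_summable_on_real)
  have inner: "(\<Sum>\<^sub>\<infinity>k. s ^ k * taylor k j) = exp (s\<^sup>2 / 2) * L (\<lambda>y. std_normal_density (y - of_int j - s))" for j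
  proof -
    have "summable (\<lambda>k. norm (s ^ k * taylor k j))"
      by (rule summable_comparison_test'[OF summable_moment[of "\<bar>s\<bar>"]]) (use taylor_le in auto)
    then show ?thesis using norm_summable_imp_has_sum[OF _ taylor_sums] infsumI by blast
  qed
  have "exp (s\<^sup>2 / 2) * L (\<lambda>t. generator c (t - (of_int n + s))) =
    (\<Sum>\<^sub>\<infinity>m. c m * (exp (s\<^sup>2 / 2) * L (\<lambda>t. std_normal_density (t - of_int (n - m) - s))))"
    unfolding generator_translate(2)[OF c] infsum_cmult_right'[symmetric]
    by (simp add: algebra_simps)
  also have "\<dots> = (\<Sum>\<^sub>\<infinity>m. \<Sum>\<^sub>\<infinity>k. c m * (s ^ k * taylor k (n - m)))"
    by (simp only: inner[symmetric] infsum_cmult_right')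
  also have "\<dots> = (\<Sum>\<^sub>\<infinity>k. \<Sum>\<^sub>\<infinity>m. c m * (s ^ k * taylor k (n - m)))"
    by (rule infsum_swap_banach[OF prod])
  also have "\<dots> = (\<Sum>\<^sub>\<infinity>k. s ^ k * gen_taylor c k n)"
    unfolding gen_taylor_def infsum_cmult_right'[symmetric] by (simp add: mult_ac)
  finally have eq: "exp (s\<^sup>2 / 2) * L (\<lambda>t. generator c (t - (of_int n + s))) = (\<Sum>\<^sub>\<infinity>k. s ^ k * gen_taylor c k n)" .
  have "(\<lambda>k. s ^ k * gen_taylor c k n) summable_on UNIV"
  proof (rule norm_summable_imp_summable_on, rule summable_comparison_test')
    show "summable (\<lambda>k. (\<Sum>\<^sub>\<infinity>m. \<bar>c m\<bar>) * (\<bar>s\<bar> ^ k * moment k))"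
      by (intro summable_mult summable_moment) simp
    show "norm (norm (s ^ k * gen_taylor c k n)) \<le> (\<Sum>\<^sub>\<infinity>m. \<bar>c m\<bar>) * (\<bar>s\<bar> ^ k * moment k)" for k
      using mult_left_mono[OF gen_taylor_le[OF c], of "\<bar>s\<bar> ^ k" k n]
      by (simp add: abs_mult power_abs mult_ac)
  qed
  then show ?thesis unfolding eq by (intro has_sum_imp_sums has_sum_infsum)
qed

lemma gen_taylor_eq_0:
  fixes a :: "int \<Rightarrow> real" and d :: "int \<Rightarrow> complex"
  assumes c: "c summable_on UNIV" and d: "d summable_on UNIV"
    and cd: "\<And>x. x \<in> {-pi..pi} \<Longrightarrow> fourier d x * fourier (\<lambda>m. of_real (c m)) x = 0"
    and d0: "x0 \<in> {-pi..pi}" "fourier d x0 \<noteq> 0"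
    and C: "C > 0" and r: "0 < r" "r < 1"
    and a: "\<And>n. a n \<noteq> 0" "\<And>n. \<bar>a n\<bar> \<le> C * r ^ nat \<bar>n\<bar>"
    and L0: "\<And>n. L (\<lambda>t. generator c (t - (of_int n + a n))) = 0"
  shows "gen_taylor c k n = 0"
proof (induction k arbitrary: n rule: less_induct)
  case (less k)
  define A where "A = (\<Sum>\<^sub>\<infinity>m. \<bar>c m\<bar>)"
  \<comment> \<open>Bounds the tail after f_k(n), up to the factor A, once a single factor a n has
    been split off: the remaining powers of a n are estimated by powers of C, and the index
    \<open>Suc i + k\<close> records the factor split off.\<close>
  define D where "D = (\<Sum>i. C ^ i * moment (Suc i + k))"
  have A: "A \<ge> 0" unfolding A_def by (rule infsum_nonneg) simp
  have summ_D: "summable (\<lambda>i. C ^ i * moment (Suc i + k))"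
  proof -
    have "summable (\<lambda>i. C ^ (i + Suc k) * moment (i + Suc k))"
      using summable_moment[of C] C by (subst summable_iff_shift[of "\<lambda>i. C ^ i * moment i"]) simp
    then have "summable (\<lambda>i. inverse (C ^ Suc k) * (C ^ (i + Suc k) * moment (i + Suc k)))"
      by (rule summable_mult)
    then show ?thesis using C by (simp add: power_add field_simps)
  qed
  have decay: "\<bar>gen_taylor c k n\<bar> \<le> (C * A * D) * r ^ nat \<bar>n\<bar>" for n
  proof -
    define s where "s = a n"
    have s: "s \<noteq> 0" "\<bar>s\<bar> \<le> C * r ^ nat \<bar>n\<bar>" "\<bar>s\<bar> \<le> C"
    proof -
      show "s \<noteq> 0" using a by (simp add: s_def)
      show "\<bar>s\<bar> \<le> C * r ^ nat \<bar>n\<bar>" using a by (simp add: s_def)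
      also have "C * r ^ nat \<bar>n\<bar> \<le> C * 1" using r C by (intro mult_left_mono power_le_one) auto
      finally show "\<bar>s\<bar> \<le> C" by simp
    qed
    have "(\<lambda>i. s ^ i * gen_taylor c i n) sums 0"
      using gen_taylor_sums[OF c, of s n] L0[of n] by (simp add: s_def)
    \<comment> \<open>The terms below k vanish by induction. Dividing the others by
      \<open>s ^ k\<close>, possible since a n is nonzero, leaves \<open>gen_taylor c k n\<close> as
      the constant term.\<close>
    then have "(\<lambda>i. s ^ (i + k) * gen_taylor c (i + k) n) sums 0"
      using less by (subst sums_iff_shift) simp
    then have "(\<lambda>i. inverse (s ^ k) * (s ^ (i + k) * gen_taylor c (i + k) n)) sums (inverse (s ^ k) * 0)"
      by (rule sums_mult)
    then have "(\<lambda>i. s ^ i * gen_taylor c (i + k) n) sums 0"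
      using s(1) by (simp add: power_add field_simps)
    then have tail: "(\<lambda>i. s ^ Suc i * gen_taylor c (Suc i + k) n) sums (- gen_taylor c k n)"
      by (subst sums_Suc_iff[of "\<lambda>i. s ^ i * gen_taylor c (i + k) n"]) simp
    have le: "\<bar>s ^ Suc i * gen_taylor c (Suc i + k) n\<bar> \<le> \<bar>s\<bar> * (A * (C ^ i * moment (Suc i + k)))" for i
    proof -
      have "\<bar>s\<bar> ^ i * \<bar>gen_taylor c (Suc i + k) n\<bar> \<le> C ^ i * (A * moment (Suc i + k))"
        using s(3) C gen_taylor_le[OF c] unfolding A_def
        by (intro mult_mono power_mono) auto
      from mult_left_mono[OF this, of "\<bar>s\<bar>"] show ?thesis
        by (simp add: abs_mult power_abs mult_ac)
    qed
    have summ_tail: "summable (\<lambda>i. \<bar>s\<bar> * (A * (C ^ i * moment (Suc i + k))))"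
      by (intro summable_mult summ_D)
    have "\<bar>gen_taylor c k n\<bar> = \<bar>\<Sum>i. s ^ Suc i * gen_taylor c (Suc i + k) n\<bar>"
      using tail by (simp add: sums_iff del: power_Suc)
    also have "\<dots> \<le> (\<Sum>i. \<bar>s\<bar> * (A * (C ^ i * moment (Suc i + k))))"
      using norm_suminf_le[OF _ summ_tail, of "\<lambda>i. s ^ Suc i * gen_taylor c (Suc i + k) n"] le
      by (simp only: real_norm_def)
    also have "\<dots> = \<bar>s\<bar> * (A * D)"
      unfolding D_def by (simp only: suminf_mult summable_mult summ_D)
    also have "\<dots> \<le> (C * r ^ nat \<bar>n\<bar>) * (A * D)"
      using A moment_nonneg C unfolding D_def
      by (intro mult_right_mono s mult_nonneg_nonneg suminf_nonneg summ_D) auto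
    finally show ?thesis by (simp add: mult_ac)
  qed
  let ?c = "\<lambda>m. complex_of_real (c m)" and ?h = "\<lambda>m. complex_of_real (taylor k m)"
  have conv: "conv ?c ?h n = of_real (gen_taylor c k n)" for n
  proof -
    have "((\<lambda>m. c m * taylor k (n - m)) has_sum gen_taylor c k n) UNIV"
      unfolding gen_taylor_def
      by (intro has_sum_infsum summable_on_mult_bounded_real(1)[OF c abs_taylor_le])
    then have "((\<lambda>m. ?c m * ?h (n - m)) has_sum of_real (gen_taylor c k n)) UNIV"
      using has_sum_of_real by fastforce
    then show ?thesis unfolding conv_def by (rule infsumI)
  qed
  have "conv ?c ?h n = 0"
  proof (rule conv_eq_0_if_decay[OF _ d _ cd d0 r])
    show "?c summable_on UNIV" using c by (rule summable_on_of_real)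
    show "norm (?h m) \<le> moment k" for m using abs_taylor_le by simp
    show "norm (conv ?c ?h n) \<le> (C * A * D) * r ^ nat \<bar>n\<bar>" for n
      unfolding conv using decay by simp
  qed
  then show ?case by (simp add: conv)
qed

end

section \<open>Complementary generators and density\<close>

lemma fourier_delta_minus:
  assumes "c summable_on UNIV"
  shows "(\<lambda>m. (if m = 0 then 1 else 0) - c m) summable_on UNIV"
    and "fourier (\<lambda>m. (if m = 0 then 1 else 0) - c m) x = 1 - fourier c x"
proof -
  have \<delta>: "((\<lambda>m::int. (if m = 0 then 1 else 0) * cis (- (of_int m * x))) has_sum 1) UNIV"
    by (rule has_sum_finite_neutralI[of "{0}"]) auto
  have c: "((\<lambda>m. c m * cis (- (of_int m * x))) has_sum fourier c x) UNIV"
    unfolding fourier_def using summable_on_mult_bounded[OF assms, of "\<lambda>m. cis (- (of_int m * x))" 1] by simp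
  show "fourier (\<lambda>m. (if m = 0 then 1 else 0) - c m) x = 1 - fourier c x"
    using has_sum_add[OF \<delta> has_sum_uminusI[OF c]]
    by (auto simp: fourier_def[of "\<lambda>m. _ m - _ m"] left_diff_distrib intro: infsumI)
  have "(\<lambda>m::int. if m = 0 then 1 else 0 :: complex) summable_on UNIV"
    by (rule finite_nonzero_values_imp_summable_on) simp
  then show "(\<lambda>m. (if m = 0 then 1 else 0) - c m) summable_on UNIV"
    using summable_on_add[of _ UNIV "\<lambda>m. - c m"] assms by (simp add: summable_on_uminus)
qed

lemma real_translates_dense:
  fixes a :: "int \<Rightarrow> real"
  assumes C: "C > 0" and r: "0 < r" "r < 1"
    and a: "\<And>n. a n \<noteq> 0" "\<And>n. \<bar>a n\<bar> \<le> C * r ^ nat \<bar>n\<bar>"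
  obtains \<phi> \<psi> :: "real \<Rightarrow> real" where
    "\<And>x. integrable lborel (\<lambda>t. \<phi> (t - x))" "\<And>x. integrable lborel (\<lambda>t. \<psi> (t - x))"
    "\<And>L f. l1_functional L \<Longrightarrow> (\<And>n. L (\<lambda>t. \<phi> (t - (of_int n + a n))) = 0) \<Longrightarrow>
      (\<And>n. L (\<lambda>t. \<psi> (t - (of_int n + a n))) = 0) \<Longrightarrow> integrable lborel f \<Longrightarrow> L f = 0"
proof -
  obtain c where c: "c summable_on UNIV"
    "\<And>x. \<bar>x\<bar> \<le> 1 \<Longrightarrow> fourier (\<lambda>m. of_real (c m)) x = 1"
    "\<And>x. 2 \<le> \<bar>x\<bar> \<Longrightarrow> \<bar>x\<bar> \<le> pi \<Longrightarrow> fourier (\<lambda>m. of_real (c m)) x = 0"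
    using trapezoid_exists[of 1 2] pi_gt3 by auto
  \<comment> \<open>The witness for the second generator: it is supported where the series of c
    equals 1, that is where the complementary series vanishes, and it is nonzero at 0.\<close>
  obtain d where d: "d summable_on UNIV"
    "\<And>x. \<bar>x\<bar> \<le> 1 / 2 \<Longrightarrow> fourier (\<lambda>m. of_real (d m)) x = 1"
    "\<And>x. 1 \<le> \<bar>x\<bar> \<Longrightarrow> \<bar>x\<bar> \<le> pi \<Longrightarrow> fourier (\<lambda>m. of_real (d m)) x = 0"
    using trapezoid_exists[of "1 / 2" 1] pi_gt3 by auto
  \<comment> \<open>The witness for the first generator is 1 minus this trapezoid: it vanishes for
    |x| \<le> 2, outside of which the series of c is zero, and it equals 1 at pi. The corners 1, 2,
    3 fit because pi > 3.\<close>
  obtain e where e: "e summable_on UNIV"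
    "\<And>x. \<bar>x\<bar> \<le> 2 \<Longrightarrow> fourier (\<lambda>m. of_real (e m)) x = 1"
    "\<And>x. 3 \<le> \<bar>x\<bar> \<Longrightarrow> \<bar>x\<bar> \<le> pi \<Longrightarrow> fourier (\<lambda>m. of_real (e m)) x = 0"
    using trapezoid_exists[of 2 3] pi_gt3 by auto
  define c' where "c' m = (if m = 0 then 1 else 0) - c m" for m
  define e' where "e' m = (if m = 0 then 1 else 0) - complex_of_real (e m)" for m
  have c'_eq: "(\<lambda>m. complex_of_real (c' m)) = (\<lambda>m. (if m = 0 then 1 else 0) - complex_of_real (c m))"
    by (auto simp: c'_def)
  have c': "c' summable_on UNIV"
    unfolding c'_def[abs_def]
    unfolding diff_conv_add_uminus
    by (intro summable_on_add summable_on_uminus[THEN iffD2] c(1) finite_nonzero_values_imp_summable_on) simp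
  note fourier_c' = fourier_delta_minus(2)[OF summable_on_of_real[OF c(1)], folded c'_eq]
  note e' = fourier_delta_minus[OF summable_on_of_real[OF e(1)], folded e'_def]
  show thesis
  proof
    show "integrable lborel (\<lambda>t. generator c (t - x))" "integrable lborel (\<lambda>t. generator c' (t - x))" for x
      by (intro integrable_generator c c')+
    fix L and f :: "real \<Rightarrow> real"
    assume L: "l1_functional L" and f: "integrable lborel f"
      and Lc: "\<And>n. L (\<lambda>t. generator c (t - (of_int n + a n))) = 0"
      and Lc': "\<And>n. L (\<lambda>t. generator c' (t - (of_int n + a n))) = 0"
    interpret l1_functional L by fact
    have 1: "gen_taylor c k n = 0" for k n
    proof (rule gen_taylor_eq_0[OF c(1) e'(1) _ _ _ C r a Lc])
      show "fourier e' x * fourier (\<lambda>m. of_real (c m)) x = 0" if "x \<in> {-pi..pi}" for x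
      proof -
        have "\<bar>x\<bar> \<le> pi" using that by auto
        then show ?thesis using c(3)[of x] e(2)[of x] e'(2)[of x] by (cases "2 \<le> \<bar>x\<bar>") auto
      qed
      show "pi \<in> {-pi..pi}" by simp
      show "fourier e' pi \<noteq> 0" using e(3)[of pi] e'(2)[of pi] pi_gt3 by simp
    qed
    have 2: "gen_taylor c' k n = 0" for k n
    proof (rule gen_taylor_eq_0[OF c' summable_on_of_real[OF d(1)] _ _ _ C r a Lc'])
      show "fourier (\<lambda>m. of_real (d m)) x * fourier (\<lambda>m. of_real (c' m)) x = 0" if "x \<in> {-pi..pi}" for x
      proof -
        have "\<bar>x\<bar> \<le> pi" using that by auto
        then show ?thesis using c(2)[of x] d(3)[of x] fourier_c'[of x] by (cases "1 \<le> \<bar>x\<bar>") auto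
      qed
      show "0 \<in> {-pi..pi}" by simp
      show "fourier (\<lambda>m. of_real (d m)) 0 \<noteq> 0" using d(2)[of 0] by simp
    qed
    \<comment> \<open>Since c and c' add up to the unit of convolution, the two vanishing
      convolutions add up to \<open>taylor k\<close> itself. Its value at 0 is the value of L on
      \<open>y ^ k * std_normal_density y\<close>, divided by k!.\<close>
    have "taylor k 0 = 0" for k
    proof -
      have summ: "(\<lambda>m. c m * taylor k (0 - m)) summable_on UNIV" "(\<lambda>m. c' m * taylor k (0 - m)) summable_on UNIV"
        by (intro summable_on_mult_bounded_real(1)[OF _ abs_taylor_le] c c')+
      have "gen_taylor c k 0 + gen_taylor c' k 0 = (\<Sum>\<^sub>\<infinity>m. c m * taylor k (0 - m) + c' m * taylor k (0 - m))"
        unfolding gen_taylor_def by (rule infsum_add[symmetric, OF summ])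
      also have "\<dots> = (\<Sum>\<^sub>\<infinity>m::int. if m = 0 then taylor k 0 else 0)"
        by (intro infsum_cong) (simp add: c'_def algebra_simps)
      also have "\<dots> = taylor k 0"
        by (intro infsumI has_sum_finite_neutralI[of "{0}"]) auto
      finally show ?thesis by (simp add: 1 2)
    qed
    then have "L (\<lambda>y. y ^ k * std_normal_density y) = 0" for k
      by (simp add: taylor_def)
    then show "L f = 0" by (rule eq_0_if_moments_eq_0[OF _ f])
  qed
qed

theorem theorem4p2:
  fixes a :: "int \<Rightarrow> real" and C r :: real
  assumes "C > 0" and "0 < r" and "r < 1"
    and "\<And>n. a n \<noteq> 0"
    and "\<And>n. \<bar>a n\<bar> \<le> C * r ^ nat \<bar>n\<bar>"
  shows "admits_pair_of_generators {real_of_int n + a n | n. True}"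
proof (rule real_translates_dense[OF assms])
  fix \<phi> \<psi> :: "real \<Rightarrow> real"
  assume int: "\<And>x. integrable lborel (\<lambda>t. \<phi> (t - x))" "\<And>x. integrable lborel (\<lambda>t. \<psi> (t - x))"
    and L0: "\<And>L f. l1_functional L \<Longrightarrow> (\<And>n. L (\<lambda>t. \<phi> (t - (of_int n + a n))) = 0) \<Longrightarrow>
      (\<And>n. L (\<lambda>t. \<psi> (t - (of_int n + a n))) = 0) \<Longrightarrow> integrable lborel f \<Longrightarrow> L f = 0"
  define \<Lambda> where "\<Lambda> = {real_of_int n + a n | n. True}"
  \<comment> \<open>Both generators share one finite set of translates; missing coefficients are
    padded with zeros, so combinations with different sets can be added.\<close>
  define comb where "comb G \<alpha> \<beta> t = (\<Sum>l\<in>G. \<alpha> l * \<phi> (t - l) + \<beta> l * \<psi> (t - l))" for G \<alpha> \<beta> t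
  have comb_int: "integrable lborel (comb G \<alpha> \<beta>)" for G \<alpha> \<beta>
    unfolding comb_def[abs_def] by (intro Bochner_Integration.integrable_sum Bochner_Integration.integrable_add integrable_mult_right int)
  have comb_mono: "comb G \<alpha> \<beta> = comb H (\<lambda>l. if l \<in> G then \<alpha> l else 0) (\<lambda>l. if l \<in> G then \<beta> l else 0)"
    if "finite H" "G \<subseteq> H" for G H \<alpha> \<beta>
    unfolding comb_def[abs_def] using that by (intro ext sum.mono_neutral_cong_left) auto
  define V where "V = {comb G \<alpha> \<beta> | G \<alpha> \<beta>. finite G \<and> G \<subseteq> \<Lambda>}"
  have dense: "\<exists>v\<in>V. (\<integral>t. \<bar>g t - v t\<bar> \<partial>lborel) < \<epsilon>" if g: "integrable lborel g" and \<epsilon>: "\<epsilon> > 0" for g :: "real \<Rightarrow> real" and \<epsilon>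
  proof (rule ccontr)
    assume "\<not> ?thesis"
    then have far: "\<epsilon> \<le> (\<integral>t. \<bar>g t - v t\<bar> \<partial>lborel)" if "v \<in> V" for v using that by force
    have comb0: "comb {} \<alpha> \<beta> = (\<lambda>_. 0)" for \<alpha> \<beta> by (simp add: comb_def[abs_def])
    have V_add: "(\<lambda>t. u t + v t) \<in> V" if "u \<in> V" "v \<in> V" for u v
    proof -
      obtain G \<alpha> \<beta> where u: "u = comb G \<alpha> \<beta>" "finite G" "G \<subseteq> \<Lambda>"
        using \<open>u \<in> V\<close> unfolding V_def by blast
      obtain H \<alpha>' \<beta>' where v: "v = comb H \<alpha>' \<beta>'" "finite H" "H \<subseteq> \<Lambda>"
        using \<open>v \<in> V\<close> unfolding V_def by blast
      have fin: "finite (G \<union> H)" using u v by simp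
      have "(\<lambda>t. u t + v t) = comb (G \<union> H) (\<lambda>l. (if l \<in> G then \<alpha> l else 0) + (if l \<in> H then \<alpha>' l else 0))
        (\<lambda>l. (if l \<in> G then \<beta> l else 0) + (if l \<in> H then \<beta>' l else 0))"
        using comb_mono[OF fin Un_upper1, of \<alpha> \<beta>] comb_mono[OF fin Un_upper2, of \<alpha>' \<beta>'] unfolding u(1) v(1)
        by (simp only: comb_def[of "G \<union> H", abs_def] sum.distrib[symmetric] distrib_right) (simp add: add_ac)
      with u v show ?thesis unfolding V_def by blast
    qed
    have V_scale: "(\<lambda>t. c * v t) \<in> V" if "v \<in> V" for c v
    proof -
      obtain G \<alpha> \<beta> where v: "v = comb G \<alpha> \<beta>" "finite G" "G \<subseteq> \<Lambda>"
        using \<open>v \<in> V\<close> unfolding V_def by blast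
      have "(\<lambda>t. c * v t) = comb G (\<lambda>l. c * \<alpha> l) (\<lambda>l. c * \<beta> l)"
        unfolding v comb_def[abs_def] by (simp add: sum_distrib_left distrib_left mult.assoc)
      with v show ?thesis unfolding V_def by blast
    qed
    have "(\<lambda>_. 0) \<in> V" unfolding V_def using comb0 by (blast intro: sym)
    moreover have "integrable lborel v" if "v \<in> V" for v
      using that comb_int unfolding V_def by auto
    ultimately obtain L where L: "l1_functional L" "\<And>v. v \<in> V \<Longrightarrow> L v = 0" "\<epsilon> \<le> L g"
      using l1_separation[OF _ _ V_add V_scale g far] by metis
    have V1: "(\<lambda>t. \<phi> (t - (of_int n + a n))) \<in> V" for n
    proof -
      have "(\<lambda>t. \<phi> (t - (of_int n + a n))) = comb {of_int n + a n} (\<lambda>_. 1) (\<lambda>_. 0)"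
        by (simp add: comb_def[abs_def])
      then show ?thesis unfolding V_def \<Lambda>_def by blast
    qed
    have V2: "(\<lambda>t. \<psi> (t - (of_int n + a n))) \<in> V" for n
    proof -
      have "(\<lambda>t. \<psi> (t - (of_int n + a n))) = comb {of_int n + a n} (\<lambda>_. 0) (\<lambda>_. 1)"
        by (simp add: comb_def[abs_def])
      then show ?thesis unfolding V_def \<Lambda>_def by blast
    qed
    have "L g = 0" by (rule L0[OF L(1) L(2)[OF V1] L(2)[OF V2] g])
    with L(3) \<epsilon> show False by simp
  qed
  have "translates_dense_L1 \<Lambda> (\<lambda>t. of_real (\<phi> t)) (\<lambda>t. of_real (\<psi> t))"
    unfolding translates_dense_L1_def
  proof (intro allI impI)
    fix f :: "real \<Rightarrow> complex" and \<epsilon> :: real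
    assume f: "integrable lborel f" and \<epsilon>: "\<epsilon> > 0"
    obtain G \<alpha> \<beta> where G: "finite G" "G \<subseteq> \<Lambda>" "(\<integral>t. \<bar>Re (f t) - comb G \<alpha> \<beta> t\<bar> \<partial>lborel) < \<epsilon> / 2"
      using dense[of "\<lambda>t. Re (f t)" "\<epsilon> / 2"] f \<epsilon> unfolding V_def by auto
    obtain H \<alpha>' \<beta>' where H: "finite H" "H \<subseteq> \<Lambda>" "(\<integral>t. \<bar>Im (f t) - comb H \<alpha>' \<beta>' t\<bar> \<partial>lborel) < \<epsilon> / 2"
      using dense[of "\<lambda>t. Im (f t)" "\<epsilon> / 2"] f \<epsilon> unfolding V_def by auto
    define F where "F = G \<union> H"
    have F: "finite F" "F \<subseteq> \<Lambda>" "G \<subseteq> F" "H \<subseteq> F" using G H by (auto simp: F_def)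
    \<comment> \<open>The generators are real, so approximating Re f and Im f separately and pairing
      the coefficients as complex numbers approximates f; each part is allotted half of the
      error.\<close>
    define c1 where "c1 l = Complex (if l \<in> G then \<alpha> l else 0) (if l \<in> H then \<alpha>' l else 0)" for l
    define c2 where "c2 l = Complex (if l \<in> G then \<beta> l else 0) (if l \<in> H then \<beta>' l else 0)" for l
    define S where "S t = (\<Sum>l\<in>F. c1 l * of_real (\<phi> (t - l))) + (\<Sum>l\<in>F. c2 l * of_real (\<psi> (t - l)))" for t
    have Re_S: "Re (S t) = comb G \<alpha> \<beta> t" for t
      unfolding comb_mono[OF F(1,3)] by (simp add: S_def comb_def c1_def c2_def sum.distrib)
    have Im_S: "Im (S t) = comb H \<alpha>' \<beta>' t" for t
      unfolding comb_mono[OF F(1,4)] by (simp add: S_def comb_def c1_def c2_def sum.distrib)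
    have S_int: "integrable lborel S"
      unfolding S_def[abs_def]
      by (intro Bochner_Integration.integrable_add Bochner_Integration.integrable_sum integrable_mult_right integrable_of_real int)
    have "(\<integral>t. norm (f t - S t) \<partial>lborel) \<le> (\<integral>t. \<bar>Re (f t) - comb G \<alpha> \<beta> t\<bar> + \<bar>Im (f t) - comb H \<alpha>' \<beta>' t\<bar> \<partial>lborel)"
    proof (rule integral_mono)
      show "norm (f t - S t) \<le> \<bar>Re (f t) - comb G \<alpha> \<beta> t\<bar> + \<bar>Im (f t) - comb H \<alpha>' \<beta>' t\<bar>" for t
        using cmod_le[of "f t - S t"] by (simp add: Re_S Im_S)
    qed (use f S_int comb_int in auto)
    also have "\<dots> = (\<integral>t. \<bar>Re (f t) - comb G \<alpha> \<beta> t\<bar> \<partial>lborel) + (\<integral>t. \<bar>Im (f t) - comb H \<alpha>' \<beta>' t\<bar> \<partial>lborel)"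
      by (rule Bochner_Integration.integral_add) (use f comb_int in auto)
    also have "\<dots> < \<epsilon>" using G(3) H(3) by simp
    finally have "(\<integral>t. norm (f t - S t) \<partial>lborel) < \<epsilon>" .
    with F(1,2) show "\<exists>F1 F2 (c1 :: real \<Rightarrow> complex) (c2 :: real \<Rightarrow> complex).
        finite F1 \<and> F1 \<subseteq> \<Lambda> \<and> finite F2 \<and> F2 \<subseteq> \<Lambda> \<and>
        (\<integral>t. norm (f t - ((\<Sum>l\<in>F1. c1 l * of_real (\<phi> (t - l))) + (\<Sum>l\<in>F2. c2 l * of_real (\<psi> (t - l))))) \<partial>lborel) < \<epsilon>"
      unfolding S_def by blast
  qed
  moreover have "integrable lborel (\<lambda>t. complex_of_real (\<phi> t))" "integrable lborel (\<lambda>t. complex_of_real (\<psi> t))"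
    using int(1)[of 0] int(2)[of 0] by (auto intro: integrable_of_real)
  ultimately show ?thesis unfolding admits_pair_of_generators_def \<Lambda>_def by blast
qed

end
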